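(* Let $\overrightarrow{G}$ be a digraph without loops or parallel arcs, let $\beta,\gamma$ be real numbers and $H(\overrightarrow{G})=\beta D(\overrightarrow{G})+\gamma A(\overrightarrow{G})$. Let $k$ be an integer. (i) For every vertex $v$ of $\overrightarrow{G}$, \begin{eqnarray*} d_k(H(\overrightarrow{G})) &=& \beta d^{+}(v)[d_{k-1}(H_v(\overrightarrow{G})) + d_k(H_v(\overrightarrow{G}))] \\ && + \sum_{\overrightarrow{C}\in \mathcal{C}_{\overrightarrow{G}}(v)} \gamma^{|V(\overrightarrow{C})|}[d_{k-|V(\overrightarrow{C})|}(H_{V(\overrightarrow{C})}(\overrightarrow{G}))-(-1)^{|V(\overrightarrow{C})|} d_k(H_{V(\overrightarrow{C})}(\overrightarrow{G}))]. \end{eqnarray*} (ii) For every arc $\overrightarrow{e}=(v,u)$ of $\overrightarrow{G}$, \begin{eqnarray*} d_k(H(\overrightarrow{G})) &=& d_k(H(\overrightarrow{G}-\overrightarrow{e})) + \beta[d_k(H_v(\overrightarrow{G}-\overrightarrow{e})) + d_{k-1}(H_v(\overrightarrow{G}-\overrightarrow{e}))] \\ && + \sum_{\overrightarrow{C}\in \mathcal{C}_{\overrightarrow{G}}(\overrightarrow{e})} \gamma^{|V(\overrightarrow{C})|}[d_{k-|V(\overrightarrow{C})|}(H_{V(\overrightarrow{C})}(\overrightarrow{G}))-(-1)^{|V(\overrightarrow{C})|} d_k(H_{V(\overrightarrow{C})}(\overrightarrow{G}))]. \end{eqnarray*}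
   Context: For an $m\times m$ matrix $M=(m_{ij})$ and an integer $j$ with $1\le j\le m$, the hook immanant is $d_j(M)=\sum_{\sigma\in S_m}\chi_{(j,1^{m-j})}(\sigma)\prod_{i=1}^m m_{i\sigma(i)}$, where $\chi_{(j,1^{m-j})}$ is the irreducible character of $S_m$ indexed by the hook partition $(j,1^{m-j})$; by convention $d_j(M)=0$ if $j<1$ or $j>m$. For a digraph $\overrightarrow{G}$ with vertices $v_1,\dots,v_n$, $A(\overrightarrow{G})=(a_{ij})$ with $a_{ij}=1$ if $(v_i,v_j)$ is an arc and $0$ otherwise, and $D(\overrightarrow{G})=\mathrm{diag}(d^+(v_1),\dots,d^+(v_n))$ with $d^+$ the out-degree; $H(\overrightarrow{G})=\beta D(\overrightarrow{G})+\gamma A(\overrightarrow{G})$. For a vertex subset $S$, $H_S(\overrightarrow{G})$ is the principal submatrix of $H(\overrightarrow{G})$ obtained by deleting rows and columns indexed by $S$; $H_v=H_{\{v\}}$. $\overrightarrow{G}-\overrightarrow{e}$ is obtained by deleting the arc $\overrightarrow{e}$, keeping all vertices. A consistently directed cycle is a directed cycle all of whose arcs follow one consistent direction; $\mathcal{C}_{\overrightarrow{G}}(v)$ (resp. $\mathcal{C}_{\overrightarrow{G}}(\overrightarrow{e})$) is the set of consistently directed cycles containing $v$ (resp. $\overrightarrow{e}$), and $|V(\overrightarrow{C})|$ is the number of vertices of $\overrightarrow{C}$.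
   Formalization: For the 0×0 matrix (a cycle through all vertices) the convention d_j=0 makes the formulas false (two opposite arcs, β=0, γ=1, k=1), so there d_j is taken to be (-1)^(j-1) for j≥1 and 0 for j<1; all else is as stated. *)

theory Defs
  imports
    "Graph_Theory.Arc_Walk"
    "HOL-Library.Function_Algebras"
    "HOL-Combinatorics.Permutations"
    Complex_Main
begin

section \<open>Trace of an operator on a finite-dimensional space of functions\<close>

interpretation fun_vs: vector_space "\<lambda>(c::real) (f::'b \<Rightarrow> real) x. c * f x"
  by unfold_locales (auto simp: fun_eq_iff algebra_simps)

definition trace_on :: "('b \<Rightarrow> real) set \<Rightarrow> (('b \<Rightarrow> real) \<Rightarrow> ('b \<Rightarrow> real)) \<Rightarrow> real" where
  "trace_on V f =
     (let B = (SOME B. fun_vs.independent B \<and> fun_vs.span B = V)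
      in \<Sum>b\<in>B. fun_vs.representation B (f b) b)"


section \<open>Irreducible characters of symmetric groups (Specht modules)\<close>

text \<open>
  The symmetric group is the group of permutations of a finite set \<open>I\<close>; for \<open>I = {1..m}\<close> it is
  \<open>S\<^sub>m\<close>. A partition is a weakly decreasing list of positive numbers. The irreducible
  representation indexed by a partition \<open>\<mu>\<close> of \<open>card I\<close> is the Specht module of \<open>\<mu>\<close>; Specht
  modules are defined over the rationals, so working over the reals gives the same characters as
  working over the complex numbers.
\<close>

definition young_diagram :: "nat list \<Rightarrow> (nat \<times> nat) set" where
  "young_diagram \<mu> = {(i, j). i < length \<mu> \<and> j < \<mu> ! i}"

definition tableaux :: "nat list \<Rightarrow> 'a set \<Rightarrow> (nat \<times> nat \<Rightarrow> 'a) set" where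
  "tableaux \<mu> I = {t. bij_betw t (young_diagram \<mu>) I}"

text \<open>A tabloid is recorded as the list of the row contents of a tableau.\<close>

definition tabloid :: "nat list \<Rightarrow> (nat \<times> nat \<Rightarrow> 'a) \<Rightarrow> 'a set list" where
  "tabloid \<mu> t = map (\<lambda>i. (\<lambda>j. t (i, j)) ` {..<\<mu> ! i}) [0..<length \<mu>]"

definition column_stabilizer :: "nat list \<Rightarrow> 'a set \<Rightarrow> (nat \<times> nat \<Rightarrow> 'a) \<Rightarrow> ('a \<Rightarrow> 'a) set" where
  "column_stabilizer \<mu> I t =
     {\<pi>. \<pi> permutes I \<and>
         (\<forall>j. let col = t ` {c \<in> young_diagram \<mu>. snd c = j} in \<pi> ` col = col)}"

text \<open>
  Elements of the permutation module on tabloids are functions from tabloids to scalars: \<open>f\<close> stands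
  for the formal linear combination with coefficient \<open>f X\<close> at the tabloid \<open>X\<close>.
\<close>

definition polytabloid :: "nat list \<Rightarrow> 'a set \<Rightarrow> (nat \<times> nat \<Rightarrow> 'a) \<Rightarrow> ('a set list \<Rightarrow> real)" where
  "polytabloid \<mu> I t =
     (\<lambda>X. \<Sum>\<pi>\<in>column_stabilizer \<mu> I t. of_int (sign \<pi>) * of_bool (tabloid \<mu> (\<pi> \<circ> t) = X))"

definition specht_module :: "nat list \<Rightarrow> 'a set \<Rightarrow> ('a set list \<Rightarrow> real) set" where
  "specht_module \<mu> I = fun_vs.span (polytabloid \<mu> I ` tableaux \<mu> I)"

text \<open>The linear extension of the action \<open>X \<mapsto> \<sigma> X\<close> on tabloids.\<close>

definition perm_action :: "('a \<Rightarrow> 'a) \<Rightarrow> ('a set list \<Rightarrow> real) \<Rightarrow> ('a set list \<Rightarrow> real)" where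
  "perm_action \<sigma> f = (\<lambda>X. f (map ((`) (inv \<sigma>)) X))"

definition sym_character :: "nat list \<Rightarrow> 'a set \<Rightarrow> ('a \<Rightarrow> 'a) \<Rightarrow> real" where
  "sym_character \<mu> I \<sigma> = trace_on (specht_module \<mu> I) (perm_action \<sigma>)"


section \<open>Hook immanants\<close>

definition hook_partition :: "nat \<Rightarrow> nat \<Rightarrow> nat list" where
  "hook_partition m j = j # replicate (m - j) 1"

text \<open>
  \<open>hook_immanant k I M\<close> is \<open>d\<^sub>k\<close> of the square matrix \<open>(M i j)\<close> with rows and columns indexed by
  the finite set \<open>I\<close>, so the principal submatrix obtained by deleting the rows and columns in \<open>S\<close>
  corresponds to the index set \<open>I - S\<close>.

  For a nonempty index set, \<open>d\<^sub>k\<close> is \<open>0\<close> unless \<open>1 \<le> k \<le> card I\<close>. The matrix of size \<open>0\<close> occurs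
  in the cycle sums exactly when the cycle passes through all vertices. There the value
  must be \<open>(-1)\<^bsup>k-1\<^esup>\<close> for \<open>k \<ge> 1\<close> and \<open>0\<close> for \<open>k \<le> 0\<close>: then, for \<open>n \<ge> 1\<close>, the difference
  \<open>d\<^bsub>k-n\<^esub> - (-1)\<^sup>n d\<^sub>k\<close> on the empty matrix equals \<open>(-1)\<^bsup>n-k\<^esup>\<close> for \<open>1 \<le> k \<le> n\<close> and \<open>0\<close>
  otherwise, which is the value of the hook character at an \<open>n\<close>-cycle. With the value \<open>0\<close> for all
  \<open>k\<close> the expansions fail already for two vertices joined by two opposite arcs.
\<close>

definition hook_immanant :: "int \<Rightarrow> 'a set \<Rightarrow> ('a \<Rightarrow> 'a \<Rightarrow> real) \<Rightarrow> real" where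
  "hook_immanant k I M =
     (if I = {} then (if 1 \<le> k then (-1) ^ nat (k - 1) else 0)
      else if 1 \<le> k \<and> k \<le> int (card I) then
        (\<Sum>\<sigma> | \<sigma> permutes I.
           sym_character (hook_partition (card I) (nat k)) I \<sigma> * (\<Prod>i\<in>I. M i (\<sigma> i)))
      else 0)"


section \<open>Matrices and cycles of a digraph\<close>

definition adj_mat :: "('a, 'b) pre_digraph \<Rightarrow> 'a \<Rightarrow> 'a \<Rightarrow> real" where
  "adj_mat G u v = (if (u, v) \<in> arcs_ends G then 1 else 0)"

definition deg_mat :: "('a, 'b) pre_digraph \<Rightarrow> 'a \<Rightarrow> 'a \<Rightarrow> real" where
  "deg_mat G u v = (if u = v then real (out_degree G u) else 0)"

definition H_mat :: "real \<Rightarrow> real \<Rightarrow> ('a, 'b) pre_digraph \<Rightarrow> 'a \<Rightarrow> 'a \<Rightarrow> real" where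
  "H_mat \<beta> \<gamma> G u v = \<beta> * deg_mat G u v + \<gamma> * adj_mat G u v"

text \<open>
  \<open>dH \<beta> \<gamma> k S G\<close> is the hook immanant \<open>d\<^sub>k\<close> of the principal submatrix of \<open>H_mat \<beta> \<gamma> G\<close> that
  remains after deleting \<open>S\<close>; degrees are taken in \<open>G\<close>.
\<close>

definition dH :: "real \<Rightarrow> real \<Rightarrow> int \<Rightarrow> 'a set \<Rightarrow> ('a, 'b) pre_digraph \<Rightarrow> real" where
  "dH \<beta> \<gamma> k S G = hook_immanant k (verts G - S) (H_mat \<beta> \<gamma> G)"

text \<open>
  A consistently directed cycle is identified with its set of arcs, so that the rotations of one
  closed walk count only once.
\<close>

definition dicycles :: "('a, 'b) pre_digraph \<Rightarrow> 'b set set" where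
  "dicycles G = {set p | p. pre_digraph.cycle G p}"

definition cycle_verts :: "('a, 'b) pre_digraph \<Rightarrow> 'b set \<Rightarrow> 'a set" where
  "cycle_verts G C = tail G ` C"

definition cycles_at_vertex :: "('a, 'b) pre_digraph \<Rightarrow> 'a \<Rightarrow> 'b set set" where
  "cycles_at_vertex G v = {C \<in> dicycles G. v \<in> cycle_verts G C}"

definition cycles_at_arc :: "('a, 'b) pre_digraph \<Rightarrow> 'b \<Rightarrow> 'b set set" where
  "cycles_at_arc G e = {C \<in> dicycles G. e \<in> C}"

end

theory Submission
  imports Defs "HOL-Combinatorics.Orbits"
begin

text \<open>
  For the hook \<open>(k, 1\<^sup>r)\<close> on \<open>I\<close> a tabloid is an injective word of length \<open>r\<close>, and the polytabloid of a
  tableau with first column \<open>c\<^sub>0, \<dots>, c\<^sub>r\<close> is the boundary of the simplex \<open>c\<^sub>0 \<and> \<dots> \<and> c\<^sub>r\<close>. Fix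
  \<open>a \<in> I\<close>. Since boundaries of boundaries vanish, the polytabloids with first column \<open>insert a S\<close>,
  where \<open>S\<close> ranges over the \<open>r\<close>-subsets of \<open>I - {a}\<close>, form a basis whose dual basis is evaluation at
  the words enumerating the sets \<open>S\<close>. This writes the character at \<open>\<sigma>\<close> as a signed count of pairs
  \<open>(S, \<pi>)\<close>, where \<open>\<pi>\<close> permutes \<open>insert a S\<close> and agrees with the inverse of \<open>\<sigma>\<close> on \<open>S\<close>. The trace does
  not depend on \<open>a\<close>, so for a cycle \<open>C\<close> of \<open>\<sigma>\<close> one may take \<open>a\<close> outside \<open>C\<close>; then \<open>S\<close> contains \<open>C\<close> or
  avoids it, which is the recursion \<open>\<chi>\<^sub>k = \<chi>\<^bsub>k-|C|\<^esub> - (-1)\<^bsup>|C|\<^esup> \<chi>\<^sub>k\<close> for removing \<open>C\<close>.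

  Sorting the permutations in the immanant by their cycle through \<open>v\<close> gives (i); the
  contributing cycles are the directed cycles of the graph. Subtracting (i) for \<open>G - e\<close> from (i) for
  \<open>G\<close>, both at the tail of \<open>e\<close>, gives (ii).
\<close>

section \<open>Traces read off from point evaluations\<close>

lemma sum_fun_apply: "(\<Sum>a\<in>A. f a) x = (\<Sum>a\<in>A. f a x)" for f :: "'a \<Rightarrow> 'b \<Rightarrow> real"
  by (induct A rule: infinite_finite_induct) auto

text \<open>\<open>trace_on\<close> chooses its basis \<open>B\<close> by \<open>SOME\<close>, so
  nothing else is known about it; this evaluates the trace through a family \<open>b\<close> whose
  coefficient functionals are evaluations at the points \<open>p i\<close>. Expanding the elements
  of \<open>B\<close> through \<open>b\<close>, and each \<open>F (b i)\<close> through
  \<open>B\<close>, is the argument for trace(XY) = trace(YX).\<close>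

lemma trace_on_eq_sum_dual:
  fixes b :: "'i \<Rightarrow> 'b \<Rightarrow> real" and p :: "'i \<Rightarrow> 'b"
  assumes "finite J" and V: "fun_vs.subspace V" and bV: "\<And>i. i \<in> J \<Longrightarrow> b i \<in> V"
    and expand: "\<And>f. f \<in> V \<Longrightarrow> f = (\<lambda>x. \<Sum>i\<in>J. f (p i) * b i x)"
    and lin: "\<And>c. F (\<lambda>x. \<Sum>i\<in>J. c i * b i x) = (\<lambda>x. \<Sum>i\<in>J. c i * F (b i) x)"
    and inv: "\<And>f. f \<in> V \<Longrightarrow> F f \<in> V"
  shows "trace_on V F = (\<Sum>i\<in>J. F (b i) (p i))"
proof -
  define B where "B = (SOME B. fun_vs.independent B \<and> fun_vs.span B = V)"
  have "\<exists>B. fun_vs.independent B \<and> fun_vs.span B = V"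
    by (metis fun_vs.basis_exists[of V] fun_vs.span_minimal V subset_antisym)
  then have B: "fun_vs.independent B" "fun_vs.span B = V"
    unfolding B_def by (metis (mono_tags, lifting) someI_ex)+
  have BV: "\<And>x. x \<in> B \<Longrightarrow> x \<in> V"
    using B(2) fun_vs.span_base by blast
  have "V \<subseteq> fun_vs.span (b ` J)"
  proof
    fix f assume "f \<in> V"
    then have "f = (\<Sum>i\<in>J. (\<lambda>x. f (p i) * b i x))"
      by (subst expand) (auto simp: fun_eq_iff sum_fun_apply)
    moreover have "(\<Sum>i\<in>J. (\<lambda>x. f (p i) * b i x)) \<in> fun_vs.span (b ` J)"
      by (intro fun_vs.span_sum fun_vs.span_scale fun_vs.span_base imageI)
    ultimately show "f \<in> fun_vs.span (b ` J)"
      by (simp only:)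
  qed
  then have "finite B"
    using fun_vs.independent_span_bound[of "b ` J" B] B \<open>finite J\<close> BV by blast
  let ?r = "fun_vs.representation B"
  have rep: "?r (F x) x = (\<Sum>i\<in>J. x (p i) * ?r (F (b i)) x)" if "x \<in> B" for x
  proof -
    have "F x = F (\<lambda>y. \<Sum>i\<in>J. x (p i) * b i y)"
      by (rule arg_cong[OF expand[OF BV[OF that]]])
    then have "F x = (\<Sum>i\<in>J. (\<lambda>y. x (p i) * F (b i) y))"
      by (simp add: lin fun_eq_iff sum_fun_apply)
    moreover have "(\<lambda>y. x (p i) * F (b i) y) \<in> fun_vs.span B" if "i \<in> J" for i
      using B(2) bV[OF that] inv fun_vs.span_scale by blast
    ultimately have "?r (F x) x = (\<Sum>i\<in>J. ?r (\<lambda>y. x (p i) * F (b i) y) x)"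
      by (simp add: fun_vs.representation_sum[OF B(1)])
    also have "\<dots> = (\<Sum>i\<in>J. x (p i) * ?r (F (b i)) x)"
      using B(2) bV inv by (intro sum.cong refl) (simp add: fun_vs.representation_scale[OF B(1)])
    finally show ?thesis .
  qed
  have "(\<Sum>x\<in>B. ?r (F x) x) = (\<Sum>x\<in>B. \<Sum>i\<in>J. x (p i) * ?r (F (b i)) x)"
    by (intro sum.cong refl rep)
  also have "\<dots> = (\<Sum>i\<in>J. \<Sum>x\<in>B. ?r (F (b i)) x * x (p i))"
    by (subst sum.swap) (simp add: mult.commute)
  \<comment> \<open>The inner sum is the expansion of \<open>F (b i)\<close> in the basis
    \<open>B\<close>, evaluated at \<open>p i\<close>.\<close>
  also have "\<dots> = (\<Sum>i\<in>J. F (b i) (p i))"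
  proof (intro sum.cong refl)
    fix i assume "i \<in> J"
    then have "(\<Sum>x\<in>B. (\<lambda>y. ?r (F (b i)) x * x y)) = F (b i)"
      using fun_vs.sum_representation_eq[OF B(1), of "F (b i)" B] B(2) inv bV \<open>finite B\<close> by auto
    from fun_cong[OF this, of "p i"]
    show "(\<Sum>x\<in>B. ?r (F (b i)) x * x (p i)) = F (b i) (p i)"
      by (simp add: sum_fun_apply)
  qed
  finally show ?thesis
    unfolding trace_on_def B_def Let_def .
qed

section \<open>Hook Specht modules\<close>

text \<open>\<open>xs\<close> is the first column below the corner. Rows are unordered, so the
  corner entry disappears into the first row.\<close>

definition hook_tabloid :: "'a set \<Rightarrow> 'a list \<Rightarrow> 'a set list" where
  "hook_tabloid I xs = (I - set xs) # map (\<lambda>x. {x}) xs"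

text \<open>\<open>cs\<close> is the whole first column, corner included. A permutation can bring
  any entry into the corner, where the tabloid forgets it; this makes the sum a simplicial
  boundary.\<close>

definition hook_poly :: "'a set \<Rightarrow> 'a list \<Rightarrow> 'a set list \<Rightarrow> real" where
  "hook_poly I cs =
     (\<lambda>X. \<Sum>\<pi> | \<pi> permutes set cs. of_int (sign \<pi>) * of_bool (hook_tabloid I (map \<pi> (tl cs)) = X))"

definition columns :: "nat \<Rightarrow> 'a set \<Rightarrow> 'a list set" where
  "columns r I = {cs. distinct cs \<and> length cs = Suc r \<and> set cs \<subseteq> I}"

lemma hook_tabloid_inj [simp]: "hook_tabloid I xs = hook_tabloid I ys \<longleftrightarrow> xs = ys"
  unfolding hook_tabloid_def by (auto dest: map_injective simp: inj_def)

lemma young_diagram_hook: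
  "young_diagram (hook_partition m k) =
     {(i, j). (i = 0 \<and> j < k) \<or> (0 < i \<and> i \<le> m - k \<and> j = 0)}"
  unfolding young_diagram_def hook_partition_def
  by (auto simp: nth_Cons split: nat.splits)

text \<open>The first row and the leg partition the diagram, so by injectivity the first row holds
  what the leg leaves out.\<close>

lemma tabloid_hook:
  assumes t: "bij_betw t (young_diagram (hook_partition m k)) I"
  shows "tabloid (hook_partition m k) t = hook_tabloid I (map (\<lambda>i. t (i, 0)) [1..<Suc (m - k)])"
proof -
  have "tabloid (hook_partition m k) t
      = (\<lambda>j. t (0, j)) ` {..<k} # map (\<lambda>i. {t (i, 0)}) [1..<Suc (m - k)]"
    unfolding tabloid_def hook_partition_def
    by (simp add: upt_conv_Cons del: upt_Suc) (auto simp: nth_Cons split: nat.splits)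
  moreover have "(\<lambda>j. t (0, j)) ` {..<k} = I - (\<lambda>i. t (i, 0)) ` {1..m - k}"
  proof -
    let ?R = "{0} \<times> {..<k}" and ?C = "{1..m - k} \<times> {0::nat}"
    have D: "young_diagram (hook_partition m k) = ?R \<union> ?C"
      by (auto simp: young_diagram_hook)
    have "t ` (?R \<union> ?C) = I" "inj_on t (?R \<union> ?C)"
      using t unfolding D bij_betw_def by auto
    moreover have "(?R \<union> ?C) - ?C = ?R"
      by auto
    ultimately have "t ` ?R = I - t ` ?C"
      using inj_on_image_set_diff[of t "?R \<union> ?C" "?R \<union> ?C" ?C] by auto
    moreover have "t ` ?R = (\<lambda>j. t (0, j)) ` {..<k}" "t ` ?C = (\<lambda>i. t (i, 0)) ` {1..m - k}"
      by auto
    ultimately show ?thesis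
      by simp
  qed
  ultimately show ?thesis
    by (simp add: hook_tabloid_def comp_def del: upt_Suc) (auto)
qed

text \<open>All columns but the first have at most one cell, so a column-preserving permutation
  fixes every entry off the first column and is arbitrary on that column. \<open>1 \<le> k\<close>
  puts the corner cell into the diagram.\<close>

lemma polytabloid_hook:
  assumes t: "t \<in> tableaux (hook_partition m k) I" and k: "1 \<le> k"
  shows "polytabloid (hook_partition m k) I t = hook_poly I (map (\<lambda>i. t (i, 0)) [0..<Suc (m - k)])"
proof -
  let ?\<mu> = "hook_partition m k"
  define cs where "cs = map (\<lambda>i. t (i, 0)) [0..<Suc (m - k)]"
  have bij: "bij_betw t (young_diagram ?\<mu>) I"
    using t by (simp add: tableaux_def)
  have "{c \<in> young_diagram ?\<mu>. snd c = 0} = (\<lambda>i. (i, 0)) ` {0..<Suc (m - k)}"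
    using k by (auto simp: young_diagram_hook)
  then have col0: "t ` {c \<in> young_diagram ?\<mu>. snd c = 0} = set cs"
    by (simp add: cs_def image_image del: upt_Suc)
  have colS: "t ` {c \<in> young_diagram ?\<mu>. snd c = Suc j} = (if Suc j < k then {t (0, Suc j)} else {})" for j
    by (auto simp: young_diagram_hook)
  have sub: "set cs \<subseteq> I"
    using bij col0 unfolding bij_betw_def by blast
  have rest: "\<exists>j. Suc j < k \<and> x = t (0, Suc j)" if "x \<in> I" "x \<notin> set cs" for x
  proof -
    obtain c where c: "c \<in> young_diagram ?\<mu>" "x = t c"
      using bij \<open>x \<in> I\<close> unfolding bij_betw_def by blast
    have "snd c \<noteq> 0"
    proof
      assume "snd c = 0"
      with c(1) have "t c \<in> t ` {c \<in> young_diagram ?\<mu>. snd c = 0}"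
        by (intro imageI CollectI conjI)
      with that(2) c(2) show False
        by (simp only: col0)
    qed
    then obtain i j where "c = (i, Suc j)"
      by (metis prod.collapse not0_implies_Suc)
    with c show ?thesis
      by (auto simp: young_diagram_hook)
  qed
  have outside: "t (0, Suc j) \<notin> set cs" if "Suc j < k" for j
  proof
    assume "t (0, Suc j) \<in> set cs"
    then have "t (0, Suc j) \<in> t ` {c \<in> young_diagram ?\<mu>. snd c = 0}"
      by (simp only: col0)
    then obtain c where c: "t (0, Suc j) = t c" "c \<in> {c \<in> young_diagram ?\<mu>. snd c = 0}"
      by (rule imageE)
    moreover have "(0, Suc j) \<in> young_diagram ?\<mu>"
      using that by (simp add: young_diagram_hook)
    moreover have "c \<in> young_diagram ?\<mu>"
      using c(2) by simp
    ultimately have "(0, Suc j) = c"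
      using inj_onD[OF bij_betw_imp_inj_on[OF bij] c(1)] by simp
    with c(2) show False
      by auto
  qed
  have stab: "column_stabilizer ?\<mu> I t = {\<pi>. \<pi> permutes set cs}"
  proof (intro set_eqI iffI)
    fix \<pi> assume "\<pi> \<in> column_stabilizer ?\<mu> I t"
    then have \<pi>: "\<pi> permutes I" and col: "\<And>j. \<pi> ` (t ` {c \<in> young_diagram ?\<mu>. snd c = j}) = t ` {c \<in> young_diagram ?\<mu>. snd c = j}"
      by (simp_all add: column_stabilizer_def)
    have "\<pi> x = x" if x: "x \<in> I - set cs" for x
    proof -
      obtain j where "Suc j < k" "x = t (0, Suc j)"
        using rest x by blast
      with col[of "Suc j"] show ?thesis
        by (simp add: colS)
    qed
    then show "\<pi> \<in> {\<pi>. \<pi> permutes set cs}"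
      using permutes_superset[OF \<pi>] by blast
  next
    fix \<pi> assume "\<pi> \<in> {\<pi>. \<pi> permutes set cs}"
    then have \<pi>: "\<pi> permutes set cs" by simp
    have "\<pi> ` (t ` {c \<in> young_diagram ?\<mu>. snd c = j}) = t ` {c \<in> young_diagram ?\<mu>. snd c = j}" for j
    proof (cases j)
      case 0
      then show ?thesis
        by (simp only: col0 permutes_image[OF \<pi>])
    next
      case (Suc j')
      then show ?thesis
        using permutes_not_in[OF \<pi> outside] by (simp add: colS)
    qed
    then show "\<pi> \<in> column_stabilizer ?\<mu> I t"
      using permutes_subset[OF \<pi> sub] by (simp add: column_stabilizer_def)
  qed
  have tab: "tabloid ?\<mu> (\<pi> \<circ> t) = hook_tabloid I (map \<pi> (tl cs))" if "\<pi> permutes set cs" for \<pi>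
  proof -
    have "bij_betw (\<pi> \<circ> t) (young_diagram ?\<mu>) I"
      using bij permutes_imp_bij[OF permutes_subset[OF that sub]] by (rule bij_betw_trans)
    from tabloid_hook[OF this] show ?thesis
      by (simp add: cs_def upt_conv_Cons del: upt_Suc)
  qed
  show ?thesis
    unfolding polytabloid_def hook_poly_def stab cs_def[symmetric]
    by (intro ext sum.cong refl) (simp add: tab)
qed

text \<open>The elements of \<open>I\<close> missing from a column can fill the arm in any order, so
  every column extends to a tableau. Hence the generators of the Specht module can be indexed by
  columns alone.\<close>

lemma columns_eq_tableaux_columns:
  assumes I: "finite I" "card I = m" and k: "1 \<le> k" "k \<le> m"
  shows "columns (m - k) I = (\<lambda>t. map (\<lambda>i. t (i, 0)) [0..<Suc (m - k)]) ` tableaux (hook_partition m k) I"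
    (is "_ = ?g ` ?T")
proof (intro set_eqI iffI)
  fix cs assume "cs \<in> columns (m - k) I"
  then have cs: "distinct cs" "length cs = Suc (m - k)" "set cs \<subseteq> I"
    by (auto simp: columns_def)
  obtain ds where ds: "distinct ds" "set ds = I - set cs"
    using finite_distinct_list[of "I - set cs"] I by auto
  have len: "length ds = k - 1"
    using ds cs I k distinct_card[of ds] distinct_card[of cs] by (simp add: card_Diff_subset)
  \<comment> \<open>The arm starts at column 1, which shifts the index into
    \<open>ds\<close>.\<close>
  define t where "t = (\<lambda>(i, j). if j = 0 then cs ! i else ds ! (j - 1))"
  let ?C = "{..m - k} \<times> {0::nat}" and ?R = "{0::nat} \<times> {1..<k}"
  have D: "young_diagram (hook_partition m k) = ?C \<union> ?R"
    using k by (auto simp: young_diagram_hook)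
  have "inj_on t ?C"
    using cs by (auto simp: inj_on_def t_def nth_eq_iff_index_eq)
  moreover have "t ` ?C = set cs"
    unfolding set_conv_nth using cs(2) by (force simp: t_def image_iff less_Suc_eq_le)
  ultimately have C: "bij_betw t ?C (set cs)"
    by (simp add: bij_betw_def)
  have "inj_on t ?R"
    using ds(1) len by (auto simp: inj_on_def t_def nth_eq_iff_index_eq)
  moreover have "t ` ?R = set ds"
  proof (intro set_eqI iffI)
    fix x assume "x \<in> set ds"
    then obtain j where "j < k - 1" "x = ds ! j"
      using len by (auto simp: in_set_conv_nth)
    then show "x \<in> t ` ?R"
      by (intro image_eqI[where x = "(0, Suc j)"]) (auto simp: t_def)
  qed (auto simp: t_def len)
  ultimately have R: "bij_betw t ?R (I - set cs)"
    using ds(2) by (simp add: bij_betw_def)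
  have "bij_betw t (?C \<union> ?R) (set cs \<union> (I - set cs))"
    using C R by (rule bij_betw_combine) auto
  moreover have "set cs \<union> (I - set cs) = I"
    using cs by auto
  ultimately have "t \<in> ?T"
    by (simp add: tableaux_def D)
  moreover have "cs = ?g t"
    using cs(2) by (intro nth_equalityI) (auto simp: t_def simp del: upt_Suc)
  ultimately show "cs \<in> ?g ` ?T"
    by blast
next
  fix cs assume "cs \<in> ?g ` ?T"
  then obtain t where t: "bij_betw t (young_diagram (hook_partition m k)) I" and cs: "cs = ?g t"
    by (auto simp: tableaux_def)
  have mem: "(i, 0) \<in> young_diagram (hook_partition m k)" if "i \<le> m - k" for i
    using that k by (auto simp: young_diagram_hook)
  have "inj_on (\<lambda>i. t (i, 0)) {..m - k}"
    using t mem unfolding bij_betw_def inj_on_def by blast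
  moreover have "set cs \<subseteq> I"
    using t mem unfolding bij_betw_def cs by (auto simp del: upt_Suc)
  ultimately show "cs \<in> columns (m - k) I"
    by (auto simp: columns_def cs distinct_map atLeast0LessThan lessThan_Suc_atMost simp del: upt_Suc)
qed

lemma specht_module_hook:
  assumes "finite I" "card I = m" "1 \<le> k" "k \<le> m"
  shows "specht_module (hook_partition m k) I = fun_vs.span (hook_poly I ` columns (m - k) I)"
  unfolding specht_module_def columns_eq_tableaux_columns[OF assms] image_image
  by (intro arg_cong[where f = fun_vs.span] image_cong refl polytabloid_hook \<open>1 \<le> k\<close>)

section \<open>Relations satisfied by hook polytabloids\<close>

lemma hook_poly_apply:
  "hook_poly I cs (hook_tabloid I xs)
     = (\<Sum>\<pi> | \<pi> permutes set cs. of_int (sign \<pi>) * of_bool (map \<pi> (tl cs) = xs))"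
  by (simp add: hook_poly_def)

text \<open>Left multiplication by \<open>\<rho>\<close> permutes the terms of the sum and
  multiplies their signs by that of \<open>\<rho>\<close>.\<close>

lemma hook_poly_map_permutes:
  assumes \<rho>: "\<rho> permutes set xs"
  shows "hook_poly I cs (hook_tabloid I (map \<rho> xs)) = of_int (sign \<rho>) * hook_poly I cs (hook_tabloid I xs)"
proof (cases "set xs \<subseteq> set cs")
  \<comment> \<open>A letter of \<open>xs\<close> outside \<open>cs\<close> makes both sides zero.
    In the other case \<open>\<rho>\<close> is also a permutation of \<open>set cs\<close>, as the
    reindexing requires.\<close>
  case False
  have *: "set ys \<subseteq> set cs" if "\<pi> permutes set cs" "map \<pi> (tl cs) = ys" for \<pi> ys
  proof -
    have "set ys \<subseteq> \<pi> ` set cs"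
      using that(2) list.set_sel(2)[of cs] by (cases cs) auto
    then show ?thesis
      using permutes_image[OF that(1)] by simp
  qed
  have "set (map \<rho> xs) = set xs"
    using permutes_image[OF \<rho>] by simp
  with False * have "\<And>\<pi>. \<pi> permutes set cs \<Longrightarrow> map \<pi> (tl cs) \<noteq> xs \<and> map \<pi> (tl cs) \<noteq> map \<rho> xs"
    by metis
  then show ?thesis
    by (auto simp: hook_poly_apply intro!: sum.neutral)
next
  case True
  then have \<rho>': "\<rho> permutes set cs"
    using \<rho> by (rule permutes_subset[rotated])
  have "hook_poly I cs (hook_tabloid I (map \<rho> xs))
      = (\<Sum>\<pi> | \<pi> permutes set cs. of_int (sign (\<rho> \<circ> \<pi>)) * of_bool (map (\<rho> \<circ> \<pi>) (tl cs) = map \<rho> xs))"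
    unfolding hook_poly_apply by (rule setum_permutations_compose_left[OF \<rho>'])
  also have "\<dots> = (\<Sum>\<pi> | \<pi> permutes set cs. of_int (sign \<rho>) * (of_int (sign \<pi>) * of_bool (map \<pi> (tl cs) = xs)))"
  proof (intro sum.cong refl)
    fix \<pi> assume "\<pi> \<in> {\<pi>. \<pi> permutes set cs}"
    then have "permutation \<pi>" "permutation \<rho>"
      using \<rho>' by (auto simp: permutation_permutes)
    moreover have "map (\<rho> \<circ> \<pi>) (tl cs) = map \<rho> xs \<longleftrightarrow> map \<pi> (tl cs) = xs"
      using inj_map_eq_map[OF permutes_inj[OF \<rho>], of "map \<pi> (tl cs)" xs] by (simp only: list.map_comp)
    ultimately show "(of_int (sign (\<rho> \<circ> \<pi>)) * of_bool (map (\<rho> \<circ> \<pi>) (tl cs) = map \<rho> xs) :: real)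
        = of_int (sign \<rho>) * (of_int (sign \<pi>) * of_bool (map \<pi> (tl cs) = xs))"
      by (simp only: sign_compose of_int_mult mult.assoc)
  qed
  finally show ?thesis
    by (simp add: hook_poly_apply sum_distrib_left)
qed

text \<open>The boundary of a boundary is zero: transposing the first two column entries cancels the terms in pairs.\<close>

lemma hook_poly_boundary:
  assumes "finite I" "cs \<in> columns (Suc r) I"
  shows "(\<Sum>y\<in>I. hook_poly I cs (hook_tabloid I (y # xs))) = 0"
proof -
  obtain c0 c1 cs' where cs: "cs = c0 # c1 # cs'"
    using assms by (cases cs; cases "tl cs") (auto simp: columns_def)
  have dist: "distinct cs" and sub: "set cs \<subseteq> I"
    using assms by (auto simp: columns_def)
  \<comment> \<open>Every \<open>\<pi>\<close> matches only the first letter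
    \<open>y = \<pi> c1\<close>, so summing over \<open>y\<close> leaves a condition on the values
    at \<open>cs'\<close>, which contains neither \<open>c0\<close> nor \<open>c1\<close>.\<close>
  define T where "T = (\<Sum>\<pi> | \<pi> permutes set cs. of_int (sign \<pi>) * of_bool (map \<pi> cs' = xs) :: real)"
  have "(\<Sum>y\<in>I. hook_poly I cs (hook_tabloid I (y # xs)))
      = (\<Sum>\<pi> | \<pi> permutes set cs. \<Sum>y\<in>I. of_int (sign \<pi>) * of_bool (\<pi> c1 = y \<and> map \<pi> cs' = xs))"
    unfolding hook_poly_apply by (subst sum.swap) (simp add: cs)
  also have "\<dots> = T"
    unfolding T_def
  proof (intro sum.cong refl)
    fix \<pi> assume "\<pi> \<in> {\<pi>. \<pi> permutes set cs}"
    then have "\<pi> c1 \<in> I"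
      using permutes_in_image[of \<pi> "set cs" c1] sub by (auto simp: cs)
    then show "(\<Sum>y\<in>I. of_int (sign \<pi>) * of_bool (\<pi> c1 = y \<and> map \<pi> cs' = xs) :: real)
        = of_int (sign \<pi>) * of_bool (map \<pi> cs' = xs)"
      using \<open>finite I\<close> by (subst sum.remove[of _ "\<pi> c1"]) (auto intro!: sum.neutral)
  qed
  also have "T = 0"
  proof -
    let ?\<tau> = "transpose c0 c1"
    have \<tau>: "?\<tau> permutes set cs"
      by (rule permutes_swap_id) (auto simp: cs)
    have "T = (\<Sum>\<pi> | \<pi> permutes set cs. of_int (sign (\<pi> \<circ> ?\<tau>)) * of_bool (map (\<pi> \<circ> ?\<tau>) cs' = xs))"
      unfolding T_def by (rule sum_permutations_compose_right[OF \<tau>])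
    also have "\<dots> = - T"
      unfolding T_def sum_negf[symmetric]
    proof (intro sum.cong refl)
      fix \<pi> assume "\<pi> \<in> {\<pi>. \<pi> permutes set cs}"
      then have "permutation \<pi>" "permutation ?\<tau>"
        using \<tau> by (auto simp: permutation_permutes)
      moreover have "map (\<pi> \<circ> ?\<tau>) cs' = map \<pi> cs'"
        using dist by (auto simp: cs transpose_def)
      ultimately show "(of_int (sign (\<pi> \<circ> ?\<tau>)) * of_bool (map (\<pi> \<circ> ?\<tau>) cs' = xs) :: real)
          = - (of_int (sign \<pi>) * of_bool (map \<pi> cs' = xs))"
        using dist by (simp add: sign_compose sign_swap_id cs del: map_eq_conv map_map)
    qed
    finally show ?thesis
      by simp
  qed
  finally show ?thesis .
qed

lemma hook_poly_support:
  assumes "cs \<in> columns r I" "hook_poly I cs X \<noteq> 0"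
  shows "\<exists>xs. X = hook_tabloid I xs \<and> distinct xs \<and> length xs = r \<and> set xs \<subseteq> I"
proof -
  obtain \<pi> where \<pi>: "\<pi> permutes set cs" "hook_tabloid I (map \<pi> (tl cs)) = X"
    using assms(2) unfolding hook_poly_def by (auto elim!: sum.not_neutral_contains_not_neutral)
  have cs: "distinct cs" "length cs = Suc r" "set cs \<subseteq> I"
    using assms by (auto simp: columns_def)
  have "set (tl cs) \<subseteq> set cs"
    by (cases cs) auto
  then have "\<pi> ` set (tl cs) \<subseteq> I"
    using permutes_image[OF \<pi>(1)] cs(3) by blast
  moreover have "distinct (map \<pi> (tl cs))"
    using cs(1) permutes_inj_on[OF \<pi>(1)] by (simp add: distinct_map distinct_tl)
  ultimately show ?thesis
    using \<pi>(2) cs(2) by (intro exI[of _ "map \<pi> (tl cs)"]) auto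
qed

lemma distinct_lists_permutes:
  assumes "distinct xs" "distinct ys" "set xs = set ys"
  shows "\<exists>\<rho>. \<rho> permutes set xs \<and> ys = map \<rho> xs"
proof -
  have len: "length xs = length ys"
    using assms by (metis distinct_card)
  define h where "h = the_inv_into {..<length xs} ((!) xs)"
  define \<rho> where "\<rho> x = (if x \<in> set xs then ys ! h x else x)" for x
  have bx: "bij_betw ((!) xs) {..<length xs} (set xs)" and b: "bij_betw ((!) ys) {..<length xs} (set xs)"
    using assms len by (auto intro: bij_betw_nth)
  have "bij_betw (\<lambda>x. ys ! h x) (set xs) (set xs)"
    using bij_betw_trans[OF bij_betw_the_inv_into[OF bx] b] by (simp add: h_def comp_def)
  then have "bij_betw \<rho> (set xs) (set xs)"
    by (rule bij_betw_cong[THEN iffD1, rotated]) (simp add: \<rho>_def)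
  then have "\<rho> permutes set xs"
    by (rule bij_imp_permutes) (simp add: \<rho>_def)
  moreover have "h (xs ! i) = i" if "i < length xs" for i
    unfolding h_def using that bx by (intro the_inv_into_f_f) (auto simp: bij_betw_def)
  then have "ys = map \<rho> xs"
    using len by (intro nth_equalityI) (auto simp: \<rho>_def)
  ultimately show ?thesis
    by blast
qed

text \<open>All three conditions are linear in \<open>f\<close>, so they pass from the generators to
  the span. They are what bounds its dimension from above in
  \<open>hook_span_eq_zero\<close>.\<close>

lemma
  assumes f: "f \<in> fun_vs.span (hook_poly I ` columns r I)"
  shows hook_span_support:
      "f X \<noteq> 0 \<Longrightarrow> \<exists>xs. X = hook_tabloid I xs \<and> distinct xs \<and> length xs = r \<and> set xs \<subseteq> I"
    and hook_span_alternating: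
      "\<rho> permutes set xs \<Longrightarrow> f (hook_tabloid I (map \<rho> xs)) = of_int (sign \<rho>) * f (hook_tabloid I xs)"
    and hook_span_boundary:
      "finite I \<Longrightarrow> r = Suc r' \<Longrightarrow> (\<Sum>y\<in>I. f (hook_tabloid I (y # xs))) = 0"
proof -
  show "\<exists>xs. X = hook_tabloid I xs \<and> distinct xs \<and> length xs = r \<and> set xs \<subseteq> I" if "f X \<noteq> 0"
    using f that
  proof (induct rule: fun_vs.span_induct_alt)
    case (step c x y)
    then show ?case
      using hook_poly_support[of _ r I X] by (cases "y X = 0") auto
  qed simp
  show "f (hook_tabloid I (map \<rho> xs)) = of_int (sign \<rho>) * f (hook_tabloid I xs)"
    if "\<rho> permutes set xs"
    using f
  proof (induct rule: fun_vs.span_induct_alt)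
    case (step c x y)
    then show ?case
      using hook_poly_map_permutes[OF that, of I] by (auto simp: algebra_simps)
  qed simp
  show "(\<Sum>y\<in>I. f (hook_tabloid I (y # xs))) = 0" if "finite I" "r = Suc r'"
    using f
  proof (induct rule: fun_vs.span_induct_alt)
    case (step c x y)
    then show ?case
      using hook_poly_boundary[OF that(1), of _ r' xs] that(2)
      by (auto simp: sum.distrib simp flip: sum_distrib_left)
  qed simp
qed

text \<open>Injective words avoiding \<open>a\<close> reduce to the chosen enumerations up to sign.
  A word containing \<open>a\<close> is brought to the form \<open>a # ys\<close>; the boundary
  relation over the first letter then expresses its value through words \<open>y # ys\<close> with
  \<open>y \<noteq> a\<close>, which either repeat a letter or avoid \<open>a\<close>.\<close>

lemma hook_span_eq_zero:
  assumes "finite I" "a \<in> I" and f: "f \<in> fun_vs.span (hook_poly I ` columns r I)"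
    and zero: "\<And>S. S \<subseteq> I - {a} \<Longrightarrow> card S = r \<Longrightarrow> f (hook_tabloid I (e S)) = 0"
    and e: "\<And>S. S \<subseteq> I - {a} \<Longrightarrow> distinct (e S) \<and> set (e S) = S"
  shows "f X = 0"
proof -
  have perm: "f (hook_tabloid I ys) = 0"
    if "f (hook_tabloid I xs) = 0" "distinct xs" "distinct ys" "set xs = set ys" for xs ys
    using hook_span_alternating[OF f, of _ xs] distinct_lists_permutes[OF that(2-4)] that(1) by auto
  have 1: "f (hook_tabloid I xs) = 0" if "distinct xs" "length xs = r" "set xs \<subseteq> I - {a}" for xs
    using zero[of "set xs"] e[of "set xs"] that distinct_card[of xs] by (simp add: perm[of "e (set xs)"])
  have 2: "f (hook_tabloid I xs) = 0" if "\<not> distinct xs" for xs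
    using hook_span_support[OF f, of "hook_tabloid I xs"] that by auto
  have 3: "f (hook_tabloid I xs) = 0" if xs: "distinct xs" "length xs = r" "set xs \<subseteq> I" "a \<in> set xs" for xs
  proof -
    let ?ys = "remove1 a xs"
    have ys: "distinct ?ys" "Suc (length ?ys) = r" "set ?ys = set xs - {a}"
      using xs length_pos_if_in_set[of a xs] by (auto simp: length_remove1)
    have "f (hook_tabloid I (y # ?ys)) = 0" if "y \<in> I - {a}" for y
    proof (cases "y \<in> set ?ys")
      case True
      then show ?thesis by (intro 2) simp
    next
      case False
      then show ?thesis
        using ys xs that by (intro 1) auto
    qed
    then have "(\<Sum>y\<in>I. f (hook_tabloid I (y # ?ys))) = f (hook_tabloid I (a # ?ys))"
      using \<open>finite I\<close> \<open>a \<in> I\<close> by (subst sum.remove[of _ a]) auto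
    then have "f (hook_tabloid I (a # ?ys)) = 0"
      using hook_span_boundary[OF f \<open>finite I\<close>, of "length ?ys" ?ys] ys(2) by simp
    then show ?thesis
      by (rule perm) (use ys xs in auto)
  qed
  show ?thesis
    using hook_span_support[OF f, of X] 1 3 by blast
qed

section \<open>Hook characters as signed counts\<close>

text \<open>For a permutation \<open>\<sigma>\<close>, \<open>\<pi>\<close> is determined on
  \<open>S\<close> and then also at \<open>a\<close>, so each \<open>S\<close> occurs at most once.
  \<open>r\<close> is an integer so that a negative leg length gives the empty set.\<close>

definition hook_terms :: "'a set \<Rightarrow> 'a \<Rightarrow> int \<Rightarrow> ('a \<Rightarrow> 'a) \<Rightarrow> ('a set \<times> ('a \<Rightarrow> 'a)) set" where
  "hook_terms I a r \<sigma> =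
     {(S, \<pi>). S \<subseteq> I - {a} \<and> int (card S) = r \<and> \<pi> permutes insert a S \<and> (\<forall>s\<in>S. \<sigma> (\<pi> s) = s)}"

lemma perm_action_hook_tabloid:
  assumes "\<sigma> permutes I"
  shows "perm_action \<sigma> f (hook_tabloid I xs) = f (hook_tabloid I (map (inv \<sigma>) xs))"
proof -
  have "inv \<sigma> ` (I - set xs) = I - inv \<sigma> ` set xs"
    using permutes_inv[OF assms] by (simp add: image_set_diff permutes_inj permutes_image)
  then show ?thesis
    by (simp add: perm_action_def hook_tabloid_def comp_def)
qed

text \<open>Conjugation by \<open>\<sigma>\<close> turns the permutations of the column
  \<open>cs\<close> into those of \<open>map \<sigma> cs\<close> without changing signs.\<close>

lemma perm_action_hook_poly:
  assumes "finite I" "\<sigma> permutes I"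
  shows "perm_action \<sigma> (hook_poly I cs) = hook_poly I (map \<sigma> cs)"
proof (intro ext)
  fix X
  have bij: "bij \<sigma>" and inv: "\<sigma> \<circ> inv \<sigma> = id" "inv \<sigma> \<circ> \<sigma> = id" "inv (inv \<sigma>) = \<sigma>"
    using assms(2) permutes_bij permutes_inv_o permutes_inv_inv by blast+
  \<comment> \<open>Stated for any bijection \<open>\<tau>\<close>: the reindexing below uses it for
    \<open>\<sigma>\<close> and, in the reverse direction, for its inverse.\<close>
  have conj: "\<tau> \<circ> \<pi> \<circ> inv \<tau> permutes \<tau> ` A" if "bij \<tau>" "\<pi> permutes A" for \<tau> \<pi> :: "'a \<Rightarrow> 'a" and A
  proof -
    have "bij (\<tau> \<circ> \<pi> \<circ> inv \<tau>)"
      using that permutes_bij[OF that(2)] by (intro bij_comp bij_imp_bij_inv) auto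
    moreover have "(\<tau> \<circ> \<pi> \<circ> inv \<tau>) x = x" if "x \<notin> \<tau> ` A" for x
    proof -
      obtain y where y: "x = \<tau> y"
        using \<open>bij \<tau>\<close> by (metis bij_pointE)
      with that have "\<pi> y = y"
        using permutes_not_in[OF \<open>\<pi> permutes A\<close>] by blast
      then show ?thesis
        using \<open>bij \<tau>\<close> by (simp add: y bij_is_inj)
    qed
    ultimately show ?thesis
      unfolding permutes_def bij_iff by blast
  qed
  have "hook_tabloid I xs = map ((`) (inv \<sigma>)) X \<longleftrightarrow> hook_tabloid I (map \<sigma> xs) = X" for xs
  proof -
    have "hook_tabloid I (map \<sigma> xs) = map ((`) \<sigma>) (hook_tabloid I xs)"
      using assms(2) by (simp add: hook_tabloid_def image_set_diff permutes_inj permutes_image)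
    moreover have "map ((`) \<sigma>) (map ((`) (inv \<sigma>)) X) = X" "map ((`) (inv \<sigma>)) (map ((`) \<sigma>) Y) = Y" for Y
      using inv by (simp_all add: comp_def image_image fun_eq_iff)
    ultimately show ?thesis
      by metis
  qed
  then have "perm_action \<sigma> (hook_poly I cs) X
      = (\<Sum>\<pi> | \<pi> permutes set cs. of_int (sign \<pi>) * of_bool (hook_tabloid I (map \<sigma> (map \<pi> (tl cs))) = X))"
    by (simp add: perm_action_def hook_poly_def)
  also have "\<dots> = hook_poly I (map \<sigma> cs) X"
    unfolding hook_poly_def
  proof (rule sum.reindex_bij_witness[of _ "\<lambda>\<pi>. inv \<sigma> \<circ> \<pi> \<circ> \<sigma>" "\<lambda>\<pi>. \<sigma> \<circ> \<pi> \<circ> inv \<sigma>"])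
    fix \<pi> assume \<pi>: "\<pi> \<in> {\<pi>. \<pi> permutes set cs}"
    then show "\<sigma> \<circ> \<pi> \<circ> inv \<sigma> \<in> {\<pi>. \<pi> permutes set (map \<sigma> cs)}"
      using conj[OF bij] by simp
    show "inv \<sigma> \<circ> (\<sigma> \<circ> \<pi> \<circ> inv \<sigma>) \<circ> \<sigma> = \<pi>"
      using inv by (simp add: fun_eq_iff)
    have "permutation \<sigma>" "permutation \<pi>" "permutation (inv \<sigma>)"
      using assms \<pi> permutes_inv by (auto simp: permutation_permutes)
    then have "sign (\<sigma> \<circ> \<pi> \<circ> inv \<sigma>) = sign \<pi>"
      by (simp add: sign_compose sign_inverse permutation_compose mult.commute)
    moreover have "map (\<sigma> \<circ> \<pi> \<circ> inv \<sigma>) (tl (map \<sigma> cs)) = map \<sigma> (map \<pi> (tl cs))"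
      using inv by (simp add: fun_eq_iff flip: map_tl)
    ultimately show "of_int (sign (\<sigma> \<circ> \<pi> \<circ> inv \<sigma>)) * of_bool (hook_tabloid I (map (\<sigma> \<circ> \<pi> \<circ> inv \<sigma>) (tl (map \<sigma> cs))) = X)
        = (of_int (sign \<pi>) * of_bool (hook_tabloid I (map \<sigma> (map \<pi> (tl cs))) = X) :: real)"
      by (simp only:)
  next
    fix \<pi> assume "\<pi> \<in> {\<pi>. \<pi> permutes set (map \<sigma> cs)}"
    then have "inv \<sigma> \<circ> \<pi> \<circ> inv (inv \<sigma>) permutes inv \<sigma> ` \<sigma> ` set cs"
      using conj[OF bij_imp_bij_inv[OF bij]] by simp
    then show "inv \<sigma> \<circ> \<pi> \<circ> \<sigma> \<in> {\<pi>. \<pi> permutes set cs}"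
      using inv by (simp add: image_comp)
    show "\<sigma> \<circ> (inv \<sigma> \<circ> \<pi> \<circ> \<sigma>) \<circ> inv \<sigma> = \<pi>"
      using inv by (simp add: fun_eq_iff)
  qed
  finally show "perm_action \<sigma> (hook_poly I cs) X = hook_poly I (map \<sigma> cs) X" .
qed

text \<open>\<open>trace_on_eq_sum_dual\<close> is applied with the \<open>b S\<close> and
  \<open>p S\<close> below; the diagonal entries are the values of \<open>b S\<close> at the words
  \<open>map (inv \<sigma>) (e S)\<close>.\<close>

lemma sym_character_hook:
  assumes "finite I" "a \<in> I" "1 \<le> k" "k \<le> card I" and \<sigma>: "\<sigma> permutes I"
  shows "sym_character (hook_partition (card I) k) I \<sigma>
    = (\<Sum>(S, \<pi>)\<in>hook_terms I a (int (card I) - int k) \<sigma>. of_int (sign \<pi>))"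
proof -
  define r where "r = card I - k"
  define V where "V = fun_vs.span (hook_poly I ` columns r I)"
  define J where "J = {S. S \<subseteq> I - {a} \<and> card S = r}"
  \<comment> \<open>An arbitrary ordering of \<open>S\<close>, shared by the column of
    \<open>b S\<close> and the evaluation word of \<open>p S\<close>, so that no sign appears in
    \<open>orth\<close>.\<close>
  define e where "e S = (SOME xs. set xs = S \<and> distinct xs)" for S :: "'a set"
  have e: "distinct (e S) \<and> set (e S) = S" if "S \<subseteq> I - {a}" for S
  proof -
    have "finite S"
      using that \<open>finite I\<close> by (meson finite_Diff finite_subset)
    from someI_ex[OF finite_distinct_list[OF this]] show ?thesis
      by (simp add: e_def)
  qed
  define b where "b S = hook_poly I (a # e S)" for S
  define p where "p S = hook_tabloid I (e S)" for S
  have "finite J"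
    using \<open>finite I\<close> unfolding J_def by auto
  have bV: "b S \<in> V" if "S \<in> J" for S
    unfolding V_def b_def
  proof (intro fun_vs.span_base imageI)
    show "a # e S \<in> columns r I"
      using that e[of S] \<open>a \<in> I\<close> distinct_card[of "e S"] by (auto simp: columns_def J_def)
  qed
  have bp: "b S (hook_tabloid I xs)
      = (\<Sum>\<pi> | \<pi> permutes insert a S \<and> map \<pi> (e S) = xs. of_int (sign \<pi>))" if "S \<in> J" for S xs
  proof -
    have "finite {\<pi>. \<pi> permutes insert a S}"
      using that \<open>finite I\<close> finite_subset[of S I] by (intro finite_permutations) (auto simp: J_def)
    then show ?thesis
      using that e[of S]
      by (simp add: b_def hook_poly_apply J_def Collect_conj_eq sum.inter_restrict of_bool_def if_distrib
          cong: if_cong)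
  qed
  \<comment> \<open>A contributing \<open>\<pi>\<close> maps \<open>S\<close> onto \<open>S'\<close>
    inside \<open>insert a S\<close>. Since \<open>a\<close> is not in \<open>S'\<close>, equal
    cardinalities give \<open>S' = S\<close>; then \<open>\<pi>\<close> fixes \<open>S\<close>
    pointwise and with it \<open>a\<close>.\<close>
  have orth: "b S (p S') = of_bool (S = S')" if S: "S \<in> J" "S' \<in> J" for S S'
  proof -
    have eS: "distinct (e S)" "set (e S) = S" "set (e S') = S'" and cards: "card S = card S'" "finite S"
      using e S \<open>finite I\<close> by (auto simp: J_def intro: finite_subset)
    have "\<pi> permutes insert a S \<and> map \<pi> (e S) = e S' \<longleftrightarrow> S = S' \<and> \<pi> = id" for \<pi>
    proof
      assume "\<pi> permutes insert a S \<and> map \<pi> (e S) = e S'"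
      then have \<pi>: "\<pi> permutes insert a S" "map \<pi> (e S) = e S'"
        by auto
      have "S' = \<pi> ` S"
        using eS \<pi>(2) by (metis set_map)
      then have "S' \<subseteq> insert a S"
        using permutes_image[OF \<pi>(1)] by blast
      then have "S' \<subseteq> S"
        using S by (auto simp: J_def)
      with cards have "S = S'"
        by (metis card_subset_eq)
      with \<pi>(2) have "map \<pi> (e S) = map id (e S)"
        by simp
      with eS have "\<pi> x = x" if "x \<in> S" for x
        using that by (metis map_eq_conv id_apply)
      then have "\<pi> permutes {a}"
        using permutes_superset[OF \<pi>(1), of "{a}"] by blast
      with \<open>S = S'\<close> show "S = S' \<and> \<pi> = id" by simp
    qed (auto simp: permutes_id)
    then show ?thesis
      unfolding p_def bp[OF S(1)] by auto
  qed
  \<comment> \<open>The error \<open>g\<close> of the proposed expansion lies in \<open>V\<close>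
    and by \<open>orth\<close> vanishes at every \<open>p S\<close>, so
    \<open>hook_span_eq_zero\<close> makes it zero.\<close>
  have expand: "f = (\<lambda>x. \<Sum>S\<in>J. f (p S) * b S x)" if f: "f \<in> V" for f
  proof -
    define g where "g = f - (\<Sum>S\<in>J. (\<lambda>x. f (p S) * b S x))"
    have g: "g x = f x - (\<Sum>S\<in>J. f (p S) * b S x)" for x
      by (simp add: g_def sum_fun_apply)
    have "g \<in> V"
      unfolding g_def using f bV unfolding V_def
      by (intro fun_vs.span_diff fun_vs.span_sum fun_vs.span_scale) auto
    moreover have "g (hook_tabloid I (e S)) = 0" if "S \<subseteq> I - {a}" "card S = r" for S
    proof -
      have S: "S \<in> J"
        using that by (simp add: J_def)
      then have "(\<Sum>S'\<in>J. f (p S') * b S' (p S)) = f (p S)"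
        using \<open>finite J\<close> by (subst sum.remove[of _ S]) (auto simp: orth intro!: sum.neutral)
      then show ?thesis
        using g[of "p S"] by (simp add: p_def)
    qed
    ultimately have "g x = 0" for x
      unfolding V_def by (rule hook_span_eq_zero[OF assms(1,2)]) (auto simp: e)
    then have "f x = (\<Sum>S\<in>J. f (p S) * b S x)" for x
      by (metis g eq_iff_diff_eq_0)
    then show ?thesis
      by (rule ext)
  qed
  have inv: "perm_action \<sigma> f \<in> V" if "f \<in> V" for f
    using that unfolding V_def
  proof (induct rule: fun_vs.span_induct_alt)
    case base
    show ?case
      using fun_vs.span_zero[of "hook_poly I ` columns r I"] by (simp add: perm_action_def zero_fun_def)
  next
    case (step c x y)
    then obtain cs where cs: "cs \<in> columns r I" "x = hook_poly I cs"
      by blast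
    have "map \<sigma> cs \<in> columns r I"
      using cs(1) \<sigma> permutes_inj_on[OF \<sigma>] permutes_in_image[OF \<sigma>]
      by (auto simp: columns_def distinct_map)
    then have "perm_action \<sigma> x \<in> fun_vs.span (hook_poly I ` columns r I)"
      unfolding cs perm_action_hook_poly[OF assms(1) \<sigma>] by (intro fun_vs.span_base imageI)
    moreover have "perm_action \<sigma> ((\<lambda>z. c * x z) + y) = (\<lambda>z. c * perm_action \<sigma> x z) + perm_action \<sigma> y"
      by (auto simp: perm_action_def)
    ultimately show ?case
      using step by (simp only: fun_vs.span_add fun_vs.span_scale)
  qed
  have "sym_character (hook_partition (card I) k) I \<sigma> = trace_on V (perm_action \<sigma>)"
    unfolding sym_character_def V_def r_def using specht_module_hook[OF assms(1) refl assms(3,4)] by simp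
  also have "\<dots> = (\<Sum>S\<in>J. perm_action \<sigma> (b S) (p S))"
    using \<open>finite J\<close> bV expand inv
    by (intro trace_on_eq_sum_dual) (auto simp: V_def perm_action_def fun_vs.subspace_span)
  also have "\<dots> = (\<Sum>S\<in>J. \<Sum>\<pi> | \<pi> permutes insert a S \<and> (\<forall>s\<in>S. \<sigma> (\<pi> s) = s). of_int (sign \<pi>))"
  proof (intro sum.cong refl)
    fix S assume S: "S \<in> J"
    have "map \<pi> (e S) = map (inv \<sigma>) (e S) \<longleftrightarrow> (\<forall>s\<in>S. \<sigma> (\<pi> s) = s)" for \<pi>
      using e[of S] S permutes_inv_eq[OF \<sigma>] by (auto simp: J_def) metis+
    then show "perm_action \<sigma> (b S) (p S)
        = (\<Sum>\<pi> | \<pi> permutes insert a S \<and> (\<forall>s\<in>S. \<sigma> (\<pi> s) = s). of_int (sign \<pi>))"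
      by (simp only: p_def perm_action_hook_tabloid[OF \<sigma>] bp[OF S])
  qed
  also have "\<dots> = (\<Sum>(S, \<pi>)\<in>(SIGMA S:J. {\<pi>. \<pi> permutes insert a S \<and> (\<forall>s\<in>S. \<sigma> (\<pi> s) = s)}). of_int (sign \<pi>))"
  proof (rule sum.Sigma[OF \<open>finite J\<close>], intro ballI)
    fix S assume "S \<in> J"
    then have "finite (insert a S)"
      using \<open>finite I\<close> finite_subset[of S I] by (auto simp: J_def)
    then show "finite {\<pi>. \<pi> permutes insert a S \<and> (\<forall>s\<in>S. \<sigma> (\<pi> s) = s)}"
      by (rule finite_subset[OF _ finite_permutations, rotated]) auto
  qed
  also have "(SIGMA S:J. {\<pi>. \<pi> permutes insert a S \<and> (\<forall>s\<in>S. \<sigma> (\<pi> s) = s)})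
      = hook_terms I a (int (card I) - int k) \<sigma>"
    using \<open>k \<le> card I\<close> by (auto simp: hook_terms_def J_def r_def)
  finally show ?thesis .
qed

section \<open>Removing a cycle from a hook character\<close>

lemma orbit_enumeration:
  fixes \<sigma> :: "'a \<Rightarrow> 'a" and v :: 'a
  assumes "permutation \<sigma>"
  defines "l \<equiv> card (orbit \<sigma> v)"
  shows "inj_on (\<lambda>i. (\<sigma> ^^ i) v) {..<l}" "orbit \<sigma> v = (\<lambda>i. (\<sigma> ^^ i) v) ` {..<l}"
    "(\<sigma> ^^ l) v = v" "0 < l"
proof -
  have self: "v \<in> orbit \<sigma> v"
    using assms(1) by (rule permutation_self_in_orbit)
  have inj: "inj_on (\<lambda>i. (\<sigma> ^^ i) v) {0..<funpow_dist1 \<sigma> v v}"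
    using self by (rule inj_on_funpow_dist1)
  moreover have orb: "orbit \<sigma> v = (\<lambda>i. (\<sigma> ^^ i) v) ` {0..<funpow_dist1 \<sigma> v v}"
    using self by (rule orbit_conv_funpow_dist1)
  ultimately have l: "l = funpow_dist1 \<sigma> v v"
    using assms(2) by (simp add: card_image)
  show "inj_on (\<lambda>i. (\<sigma> ^^ i) v) {..<l}" "orbit \<sigma> v = (\<lambda>i. (\<sigma> ^^ i) v) ` {..<l}" "0 < l"
    using inj orb unfolding l by (simp_all add: atLeast0LessThan)
  show "(\<sigma> ^^ l) v = v"
    unfolding l using self by (rule funpow_dist1_prop)
qed

lemma perm_restrict_cyclic_permutes:
  assumes "\<sigma> permutes I" "cyclic_on \<sigma> C"
  shows "perm_restrict \<sigma> C permutes C"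
proof -
  have "bij_betw \<sigma> C C"
    using permutes_inj_on[OF assms(1), of C] cyclic_on_inI[OF assms(2)] finite_cyclic_on[OF assms(2)]
    by (metis bij_betw_def endo_inj_surj image_subsetI)
  then have "bij_betw (perm_restrict \<sigma> C) C C"
    by (rule bij_betw_cong[THEN iffD1, rotated]) (simp add: perm_restrict_def)
  then show ?thesis
    by (rule bij_imp_permutes) (simp add: perm_restrict_def)
qed

lemma orbit_perm_restrict_self:
  assumes "permutation \<sigma>"
  shows "orbit (perm_restrict \<sigma> (orbit \<sigma> v)) v = orbit \<sigma> v"
  by (rule orbit_cong[OF permutation_self_in_orbit[OF assms]]) (simp add: perm_restrict_def)

text \<open>The cycle is built one point at a time, each by one transposition, so that its sign is
  known; other cycles are compared with it.\<close>

lemma cycle_permutation_exists: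
  assumes "inj_on x {..r}"
  shows "\<exists>\<kappa>. \<kappa> permutes x ` {..r} \<and> (\<forall>i<r. \<kappa> (x i) = x (Suc i)) \<and> \<kappa> (x r) = x 0 \<and> sign \<kappa> = (-1) ^ r"
  using assms
proof (induct r)
  case 0
  then show ?case by (intro exI[of _ id]) auto
next
  case (Suc r)
  have "inj_on x {..r}"
    using Suc.prems by (rule inj_on_subset) auto
  with Suc.hyps obtain \<kappa> where \<kappa>: "\<kappa> permutes x ` {..r}" "\<forall>i<r. \<kappa> (x i) = x (Suc i)"
      "\<kappa> (x r) = x 0" "sign \<kappa> = (-1) ^ r"
    by auto
  have neq: "x i \<noteq> x (Suc r)" "x (Suc i) \<noteq> x 0" if "i \<le> r" for i
    using that inj_onD[OF Suc.prems, of i "Suc r"] inj_onD[OF Suc.prems, of "Suc i" 0] by auto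
  \<comment> \<open>\<open>\<kappa>\<close> returns \<open>x r\<close> to \<open>x 0\<close>, which
    \<open>?\<tau>\<close> redirects to the new point; the new point is fixed by
    \<open>\<kappa>\<close> and sent to \<open>x 0\<close> by \<open>?\<tau>\<close>.\<close>
  let ?\<tau> = "transpose (x 0) (x (Suc r))"
  have \<tau>: "?\<tau> permutes x ` {..Suc r}"
    by (rule permutes_swap_id) auto
  have \<kappa>': "\<kappa> permutes x ` {..Suc r}"
    using \<kappa>(1) by (rule permutes_subset) auto
  have fin: "finite (x ` {..Suc r})" by simp
  have "x (Suc r) \<notin> x ` {..r}"
  proof
    assume "x (Suc r) \<in> x ` {..r}"
    then obtain i where "i \<le> r" "x (Suc r) = x i" by auto
    with neq(1)[of i] show False by simp
  qed
  then have last: "\<kappa> (x (Suc r)) = x (Suc r)"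
    using permutes_not_in[OF \<kappa>(1)] by blast
  have "(?\<tau> \<circ> \<kappa>) (x i) = x (Suc i)" if "i < Suc r" for i
  proof (cases "i = r")
    case True
    then show ?thesis using \<kappa>(3) by simp
  next
    case False
    then have "Suc i \<le> r" using that by simp
    then show ?thesis
      using \<kappa>(2) neq[of i] neq(1)[of "Suc i"] by (simp add: transpose_apply_other)
  qed
  moreover have "sign (?\<tau> \<circ> \<kappa>) = (-1) ^ Suc r"
    using permutes_imp_permutation[OF fin \<tau>] permutes_imp_permutation[OF fin \<kappa>'] neq(1)[of 0] \<kappa>(4)
    by (simp add: sign_compose sign_swap_id)
  moreover have "(?\<tau> \<circ> \<kappa>) (x (Suc r)) = x 0"
    by (simp add: last)
  ultimately show ?case
    using permutes_compose[OF \<kappa>' \<tau>] by blast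
qed

text \<open>The image of \<open>a\<close> is forced once the others are known:
  \<open>inv q \<circ> p\<close> fixes \<open>S\<close> and so permutes a singleton.\<close>

lemma permutes_insert_eqI:
  assumes "p permutes insert a S" "q permutes insert a S" "\<And>s. s \<in> S \<Longrightarrow> p s = q s"
  shows "p = q"
proof -
  have "inv q \<circ> p permutes insert a S"
    using assms permutes_compose permutes_inv by blast
  then have "inv q \<circ> p permutes {a}"
    by (rule permutes_superset) (use assms permutes_inverses(2)[OF assms(2)] in auto)
  then have "inv q \<circ> p = id"
    by simp
  then show ?thesis
    using permutes_inv_o(1)[OF assms(2)] by (metis comp_assoc comp_id id_comp)
qed

text \<open>\<open>c\<close> agrees with the explicit cycle along its orbit, and both fix everything
  else. Writing the sign as minus a power avoids a truncated exponent and matches the removal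
  rule.\<close>

lemma sign_cyclic_permutation:
  assumes c: "c permutes orbit c v" "finite (orbit c v)"
  shows "sign c = - ((-1) ^ card (orbit c v))"
proof -
  define x where "x i = (c ^^ i) v" for i
  define r where "r = card (orbit c v) - 1"
  have perm: "permutation c"
    using c permutation_permutes by blast
  note enum = orbit_enumeration[OF perm, of v, folded x_def]
  have l: "card (orbit c v) = Suc r"
    using enum(4) by (simp add: r_def)
  obtain \<kappa> where \<kappa>: "\<kappa> permutes x ` {..r}" "\<forall>i<r. \<kappa> (x i) = x (Suc i)" "\<kappa> (x r) = x 0" "sign \<kappa> = (-1) ^ r"
    using cycle_permutation_exists[of x r] enum(1) unfolding l lessThan_Suc_atMost by blast
  have orb: "orbit c v = x ` {..r}"
    using enum(2) unfolding l lessThan_Suc_atMost .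
  have "\<kappa> (x i) = c (x i)" if "i \<le> r" for i
  proof (cases "i = r")
    case True
    have "c (x r) = x (Suc r)" by (simp add: x_def)
    also have "\<dots> = x 0" using enum(3) by (simp add: l) (simp add: x_def)
    finally show ?thesis using True \<kappa>(3) by simp
  next
    case False
    then show ?thesis using \<kappa>(2) that by (simp add: x_def)
  qed
  then have "\<kappa> y = c y" for y
    using permutes_not_in[OF \<kappa>(1)] permutes_not_in[OF c(1)] orb by (cases "y \<in> orbit c v") auto
  then have "\<kappa> = c" by blast
  with \<kappa>(4) show ?thesis by (simp add: l)
qed

section \<open>Hook characters for all integer indices\<close>

text \<open>The conventions of \<open>hook_immanant\<close> are moved into the character. This makes
  every immanant a single sum over permutations: on the empty set only the identity remains, with
  empty product 1.\<close>

definition hook_char :: "int \<Rightarrow> 'a set \<Rightarrow> ('a \<Rightarrow> 'a) \<Rightarrow> real" where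
  "hook_char k I \<sigma> =
     (if I = {} then (if 1 \<le> k then (-1) ^ nat (k - 1) else 0)
      else if 1 \<le> k \<and> k \<le> int (card I) then sym_character (hook_partition (card I) (nat k)) I \<sigma>
      else 0)"

lemma hook_immanant_eq_sum_hook_char:
  "hook_immanant k I M = (\<Sum>\<sigma> | \<sigma> permutes I. hook_char k I \<sigma> * (\<Prod>i\<in>I. M i (\<sigma> i)))"
  by (auto simp: hook_immanant_def hook_char_def)

text \<open>Outside the range of \<open>k\<close> there are no terms: \<open>k < 1\<close> would ask
  for at least \<open>card I\<close> elements in \<open>I - {a}\<close>, and
  \<open>k > card I\<close> for a negative number.\<close>

lemma hook_char_eq_sum_hook_terms:
  assumes "finite I" "a \<in> I" "\<sigma> permutes I"
  shows "hook_char k I \<sigma> = (\<Sum>(S, \<pi>)\<in>hook_terms I a (int (card I) - k) \<sigma>. of_int (sign \<pi>))"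
proof (cases "1 \<le> k \<and> k \<le> int (card I)")
  case True
  then have k: "1 \<le> nat k" "nat k \<le> card I" "int (nat k) = k"
    by auto
  then show ?thesis
    using True assms(2) sym_character_hook[OF assms(1,2) k(1,2) assms(3)] k(3) by (auto simp: hook_char_def)
next
  case False
  have less: "card S < card I" if "S \<subseteq> I - {a}" for S
    using that assms by (intro psubset_card_mono) auto
  have "hook_terms I a (int (card I) - k) \<sigma> = {}"
  proof (rule equals0I)
    fix z assume "z \<in> hook_terms I a (int (card I) - k) \<sigma>"
    then obtain S where "S \<subseteq> I - {a}" "int (card S) = int (card I) - k"
      by (auto simp: hook_terms_def)
    with less[of S] False show False
      by auto
  qed
  moreover have "I \<noteq> {}"
    using assms(2) by blast
  then have "hook_char k I \<sigma> = 0"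
    by (simp only: hook_char_def False if_False)
  ultimately show ?thesis
    by simp
qed

text \<open>Used for the positions of \<open>S\<close> along an orbit starting at \<open>a\<close>,
  where \<open>a\<close> itself has position 0.\<close>

lemma down_closed_eq_atLeastAtMost:
  fixes A :: "nat set"
  assumes "finite A" "0 \<notin> A" and down: "\<And>i. Suc i \<in> A \<Longrightarrow> i \<noteq> 0 \<Longrightarrow> i \<in> A"
  shows "A = {1..card A}"
proof -
  have ex: "\<exists>n. A = {1..n}"
  proof (cases "A = {}")
    case False
    have less: "i \<in> A \<Longrightarrow> j \<le> i \<Longrightarrow> 0 < j \<Longrightarrow> j \<in> A" for i j
    proof (induct i)
      case (Suc i)
      then show ?case using down[of i] by (cases "j = Suc i") auto
    qed simp
    have "A = {1..Max A}"
    proof (intro set_eqI iffI)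
      fix i assume "i \<in> A"
      then show "i \<in> {1..Max A}"
        using assms(1,2) by (cases i) auto
    next
      fix i assume "i \<in> {1..Max A}"
      then show "i \<in> A"
        using less[OF Max_in[OF assms(1) False], of i] by simp
    qed
    then show ?thesis by blast
  qed (auto intro: exI[of _ 0])
  then show ?thesis by auto
qed

text \<open>\<open>\<pi>\<close> moves each element of \<open>S\<close> one step back along the
  cycle, and \<open>a\<close> is the only place outside \<open>S\<close> where it can land. Hence
  \<open>S\<close> is the segment following \<open>a\<close>, and \<open>\<pi>\<close> is the
  backward cycle on this segment together with \<open>a\<close>: a single term.\<close>

lemma hook_terms_full_cycle:
  assumes "finite I" and \<sigma>: "\<sigma> permutes I" and I: "I = orbit \<sigma> a" and r: "r < card I"
  shows "(\<Sum>(S, \<pi>)\<in>hook_terms I a (int r) \<sigma>. of_int (sign \<pi>)) = ((-1) ^ r :: real)"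
proof -
  define x where "x i = (\<sigma> ^^ i) a" for i
  have "permutation \<sigma>"
    using assms permutation_permutes by blast
  note enum = orbit_enumeration[OF this, of a, folded x_def, folded I]
  have x0: "x 0 = a" and xSuc: "\<sigma> (x i) = x (Suc i)" for i
    by (simp_all add: x_def)
  have inj: "inj_on x {..r}"
    using enum(1) by (rule inj_on_subset) (use r in auto)
  obtain \<kappa> where \<kappa>: "\<kappa> permutes x ` {..r}" "\<forall>i<r. \<kappa> (x i) = x (Suc i)" "\<kappa> (x r) = x 0" "sign \<kappa> = (-1) ^ r"
    using cycle_permutation_exists[OF inj] by blast
  let ?S = "x ` {1..r}"
  have ins: "x ` {..r} = insert a ?S"
  proof -
    have "{..r} = insert 0 {1..r}" by auto
    then show ?thesis by (metis image_insert x0)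
  qed
  have S_alt: "?S = (\<lambda>i. x (Suc i)) ` {..<r}"
    unfolding image_Suc_lessThan[symmetric] image_image ..
  have inv\<kappa>: "inv \<kappa> (x (Suc i)) = x i" if "i < r" for i
    using \<kappa>(1,2) that by (simp add: permutes_inv_eq)
  have "hook_terms I a (int r) \<sigma> = {(?S, inv \<kappa>)}"
  proof (intro set_eqI iffI)
    fix z assume z: "z \<in> hook_terms I a (int r) \<sigma>"
    obtain S \<pi> where z_eq: "z = (S, \<pi>)" by (cases z)
    with z have S: "S \<subseteq> I - {a}" "card S = r" and \<pi>: "\<pi> permutes insert a S"
        "\<And>s. s \<in> S \<Longrightarrow> \<sigma> (\<pi> s) = s"
      by (auto simp: hook_terms_def)
    have step: "\<pi> (x (Suc i)) = x i" if "x (Suc i) \<in> S" for i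
      using \<pi>(2)[OF that] permutes_inj[OF \<sigma>] by (simp add: xSuc[symmetric] inj_eq)
    define A where "A = {i. i < card I \<and> x i \<in> S}"
    have "x i \<in> S" if "x (Suc i) \<in> S" "i \<noteq> 0" "Suc i < card I" for i
    proof -
      have "x i \<in> insert a S"
        using step[OF that(1)] permutes_in_image[OF \<pi>(1), of "x (Suc i)"] that(1) by simp
      moreover have "x i \<noteq> x 0"
        using inj_onD[OF enum(1), of i 0] that by auto
      ultimately show ?thesis by (simp add: x0)
    qed
    then have "A = {1..card A}"
      using S(1) x0 by (intro down_closed_eq_atLeastAtMost) (auto simp: A_def)
    moreover have "S = x ` A"
      using S(1) enum(2) by (auto simp: A_def)
    moreover have "inj_on x A"
      using enum(1) by (rule inj_on_subset) (auto simp: A_def)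
    ultimately have S_eq: "S = ?S"
      using S(2) by (metis card_image)
    have "\<pi> = inv \<kappa>"
    proof (rule permutes_insert_eqI[OF \<pi>(1)])
      show "inv \<kappa> permutes insert a S"
        using permutes_inv[OF \<kappa>(1)] by (simp add: ins S_eq)
      fix s assume s: "s \<in> S"
      then obtain i where i: "s = x (Suc i)" "i < r"
        unfolding S_eq S_alt by auto
      then show "\<pi> s = inv \<kappa> s"
        using step inv\<kappa> s by simp
    qed
    then show "z \<in> {(?S, inv \<kappa>)}"
      by (simp add: z_eq S_eq)
  next
    fix z assume "z \<in> {(?S, inv \<kappa>)}"
    then have z: "z = (?S, inv \<kappa>)" by simp
    have "?S \<subseteq> I - {a}"
    proof
      fix y assume "y \<in> ?S"
      then obtain i where i: "y = x i" "1 \<le> i" "i \<le> r" by auto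
      then have "x i \<noteq> x 0"
        using inj_onD[OF enum(1), of i 0] r by auto
      then show "y \<in> I - {a}"
        using i r enum(2) x0 by auto
    qed
    moreover have "card ?S = r"
      using inj by (subst card_image) (auto intro: inj_on_subset)
    moreover have "\<sigma> (inv \<kappa> s) = s" if s: "s \<in> ?S" for s
    proof -
      obtain i where i: "s = x (Suc i)" "i < r"
        using s unfolding S_alt by auto
      then show ?thesis by (simp add: inv\<kappa> xSuc)
    qed
    ultimately show "z \<in> hook_terms I a (int r) \<sigma>"
      unfolding z hook_terms_def using permutes_inv[OF \<kappa>(1)] by (auto simp: ins)
  qed
  moreover have "sign (inv \<kappa>) = (-1) ^ r"
    using \<kappa>(1,4) permutes_imp_permutation[of "x ` {..r}" \<kappa>] by (simp add: sign_inverse)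
  ultimately show ?thesis
    by simp
qed

text \<open>With \<open>I\<close> a single orbit there is no base point outside the cycle, so this
  case of the removal rule is computed directly. For \<open>k < 1\<close> both terms on the right
  vanish, for \<open>1 \<le> k \<le> card I\<close> only the second survives, and for larger
  \<open>k\<close> they cancel.\<close>

lemma hook_char_full_cycle:
  assumes "finite I" "\<sigma> permutes I" "I = orbit \<sigma> a"
  shows "hook_char k I \<sigma> = hook_char (k - int (card I)) {} id - (-1) ^ card I * hook_char k {} id"
proof -
  have a: "a \<in> I"
    using assms permutation_self_in_orbit permutation_permutes by metis
  then have l: "0 < card I"
    using assms(1) by (auto simp: card_gt_0_iff)
  consider "k < 1" | "1 \<le> k" "k \<le> int (card I)" | "int (card I) < k" by linarith
  then show ?thesis
  proof cases
    case 1
    then show ?thesis using a l by (auto simp: hook_char_def)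
  next
    case 2
    \<comment> \<open>\<open>n\<close> and \<open>r\<close> replace truncated differences, so that
      \<open>power_add\<close> can compare the exponents.\<close>
    define n where "n = nat k - 1"
    define r where "r = card I - nat k"
    have k: "k = int (Suc n)" "card I = Suc n + r"
      using 2 by (simp_all add: n_def r_def)
    have "hook_char k I \<sigma> = (-1) ^ r"
      using hook_char_eq_sum_hook_terms[OF assms(1) a assms(2), of k] hook_terms_full_cycle[OF assms, of r] k
      by simp
    then show ?thesis
      using k by (simp add: hook_char_def power_add)
  next
    case 3
    define n where "n = nat (k - int (card I)) - 1"
    have k: "k = int (Suc n) + int (card I)"
      using 3 by (simp add: n_def)
    have "nat (k - 1) = n + card I"
      using k by simp
    then show ?thesis
      using 3 a k by (auto simp: hook_char_def power_add)
  qed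
qed

text \<open>For \<open>s\<close> in both sets, \<open>\<pi> s\<close> is the predecessor of
  \<open>s\<close> on \<open>C\<close> and lies in \<open>insert a S\<close>, hence in
  \<open>S\<close> because \<open>a\<close> is off \<open>C\<close>. So the intersection is closed
  under predecessors on the cycle; if nonempty, it is all of \<open>C\<close>.\<close>

lemma hook_terms_orbit_dichotomy:
  assumes "finite I" and \<sigma>: "\<sigma> permutes I" and cyc: "cyclic_on \<sigma> C" and "a \<notin> C"
    and "(S, \<pi>) \<in> hook_terms I a r \<sigma>" and "C \<inter> S \<noteq> {}"
  shows "C \<subseteq> S"
proof -
  have S: "finite S" and \<pi>: "\<pi> permutes insert a S" "\<And>s. s \<in> S \<Longrightarrow> \<sigma> (\<pi> s) = s"
    using assms(1,5) by (auto simp: hook_terms_def intro: finite_subset)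
  have "C \<inter> S \<subseteq> \<sigma> ` (C \<inter> S)"
  proof
    fix s assume s: "s \<in> C \<inter> S"
    then have "\<pi> s \<in> C"
      using cyclic_on_f_in[OF \<sigma> cyc] \<pi>(2) by simp
    moreover have "\<pi> s \<in> insert a S"
      using permutes_in_image[OF \<pi>(1)] s by simp
    ultimately have "\<pi> s \<in> C \<inter> S"
      using \<open>a \<notin> C\<close> by auto
    then show "s \<in> \<sigma> ` (C \<inter> S)"
      using \<pi>(2) s by (metis IntD2 imageI)
  qed
  \<comment> \<open>Finiteness turns the inclusion into an equality, which gives the closure under
    \<open>\<sigma>\<close> itself that the orbit induction needs.\<close>
  then have eq: "\<sigma> ` (C \<inter> S) = C \<inter> S"
    using S by (metis card_seteq card_image_le finite_Int finite_imageI)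
  obtain x where x: "x \<in> C \<inter> S"
    using assms(6) by blast
  have "orbit \<sigma> x \<subseteq> C \<inter> S"
  proof
    fix y assume "y \<in> orbit \<sigma> x"
    then show "y \<in> C \<inter> S"
      by induct (use x eq in blast)+
  qed
  then show ?thesis
    using orbit_cyclic_eq3[OF cyc] x by blast
qed

text \<open>Terms avoiding \<open>C\<close> are terms for \<open>I - C\<close> with the same leg
  length. From the others \<open>C\<close> is split off, which shortens the leg by
  \<open>card C\<close> and contributes the sign of a cycle.\<close>

lemma hook_char_remove_orbit:
  assumes "finite I" and \<sigma>: "\<sigma> permutes I" and v: "v \<in> I"
  defines "C \<equiv> orbit \<sigma> v"
  defines "\<sigma>' \<equiv> perm_restrict \<sigma> (I - C)"
  shows "hook_char k I \<sigma>
    = hook_char (k - int (card C)) (I - C) \<sigma>' - (-1) ^ card C * hook_char k (I - C) \<sigma>'"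
proof (cases "I = C")
  case True
  then have "\<sigma>' = id"
    by (auto simp: \<sigma>'_def perm_restrict_def)
  then show ?thesis
    using hook_char_full_cycle[OF assms(1) \<sigma>, of v k] True by (simp add: C_def)
next
  case False
  have CI: "C \<subseteq> I"
    using permutes_orbit_subset[OF \<sigma> v] by (simp add: C_def)
  with False obtain a where a: "a \<in> I" "a \<notin> C" by blast
  have finC: "finite C"
    using CI assms(1) by (rule finite_subset)
  have perm\<sigma>: "permutation \<sigma>"
    using assms permutation_permutes by blast
  have cyc: "cyclic_on \<sigma> C"
    using cyclic_on_orbit'[OF perm\<sigma>] by (simp add: C_def)
  define c where "c = perm_restrict \<sigma> C"
  have c: "c permutes C"
    unfolding c_def using \<sigma> cyc by (rule perm_restrict_cyclic_permutes)
  have orb: "orbit c v = C"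
    unfolding c_def C_def using perm\<sigma> by (rule orbit_perm_restrict_self)
  have signc: "sign c = - ((-1) ^ card C)"
    using sign_cyclic_permutation[of c v] c finC unfolding orb by blast
  have permc: "permutation c"
    using c finC permutation_permutes by blast
  have \<sigma>': "\<sigma>' permutes I - C"
    unfolding \<sigma>'_def using \<sigma> cyc by (rule perm_restrict_diff_cyclic)
  have \<sigma>'_eq: "\<sigma>' x = \<sigma> x" if "x \<in> I - C" for x
    using that by (simp add: \<sigma>'_def perm_restrict_def)
  \<comment> \<open>Off \<open>C\<close>, the predecessor under \<open>\<sigma>\<close> is again off
    \<open>C\<close>, so there \<open>\<sigma>\<close> and \<open>\<sigma>'\<close> impose the same
    condition on \<open>\<pi>\<close>.\<close>
  have stay: "\<pi> s \<in> I - C" if "s \<in> I - C" "\<sigma> (\<pi> s) = s" for \<pi> s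
    using that cyclic_on_inI[OF cyc, of "\<pi> s"] permutes_in_image[OF \<sigma>, of "\<pi> s"] by auto
  define r where "r = int (card I) - k"
  let ?P = "hook_terms I a r \<sigma>"
  have finP: "finite ?P"
  proof (rule finite_subset)
    show "?P \<subseteq> Pow I \<times> {\<pi>. \<pi> permutes I}"
      using a by (auto simp: hook_terms_def intro: permutes_subset)
    show "finite (Pow I \<times> {\<pi>. \<pi> permutes I})"
      using assms(1) by (simp add: finite_permutations)
  qed
  define P0 where "P0 = {z \<in> ?P. C \<inter> fst z = {}}"
  define P1 where "P1 = {z \<in> ?P. C \<subseteq> fst z}"
  have "z \<in> P0 \<union> P1" if "z \<in> ?P" for z
    using hook_terms_orbit_dichotomy[OF assms(1) \<sigma> cyc a(2), of "fst z" "snd z" r] that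
    unfolding P0_def P1_def by simp blast
  then have "?P = P0 \<union> P1"
    by (auto simp: P0_def P1_def)
  moreover have "v \<in> C"
    using permutation_self_in_orbit[OF perm\<sigma>] by (simp add: C_def)
  then have "P0 \<inter> P1 = {}"
    by (auto simp: P0_def P1_def)
  ultimately have split: "(\<Sum>(S, \<pi>)\<in>?P. of_int (sign \<pi>) :: real)
      = (\<Sum>(S, \<pi>)\<in>P0. of_int (sign \<pi>)) + (\<Sum>(S, \<pi>)\<in>P1. of_int (sign \<pi>))"
    using finP by (metis finite_Un sum.union_disjoint)
  have P0_eq: "P0 = hook_terms (I - C) a r \<sigma>'"
  proof (intro set_eqI iffI)
    fix z assume "z \<in> P0"
    then obtain S \<pi> where z: "z = (S, \<pi>)" "S \<subseteq> I - {a}" "C \<inter> S = {}" "int (card S) = r"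
        "\<pi> permutes insert a S" "\<forall>s\<in>S. \<sigma> (\<pi> s) = s"
      by (auto simp: P0_def hook_terms_def)
    have "\<sigma>' (\<pi> s) = s" if "s \<in> S" for s
    proof -
      have "\<pi> s \<in> I - C"
        using that z(2,3,6) by (intro stay[where \<pi> = \<pi> and s = s]) auto
      then show ?thesis
        using that z(6) by (simp add: \<sigma>'_eq)
    qed
    with z show "z \<in> hook_terms (I - C) a r \<sigma>'"
      by (auto simp: hook_terms_def)
  next
    fix z assume "z \<in> hook_terms (I - C) a r \<sigma>'"
    then obtain S \<pi> where z: "z = (S, \<pi>)" "S \<subseteq> I - C - {a}" "int (card S) = r"
        "\<pi> permutes insert a S" "\<forall>s\<in>S. \<sigma>' (\<pi> s) = s"
      by (auto simp: hook_terms_def)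
    have "\<pi> s \<in> I - C" if "s \<in> S" for s
      using permutes_in_image[OF z(4), of s] that z(2) a by auto
    then have "\<forall>s\<in>S. \<sigma> (\<pi> s) = s"
      using z(5) \<sigma>'_eq by auto
    with z show "z \<in> P0"
      by (auto simp: P0_def hook_terms_def)
  qed
  \<comment> \<open>On \<open>C\<close> the permutation \<open>\<pi>\<close> inverts
    \<open>c\<close>, so \<open>\<pi> \<circ> c\<close> fixes \<open>C\<close> pointwise and
    permutes \<open>insert a (S - C)\<close>. Composing with \<open>inv c\<close> reverses
    this.\<close>
  have P1_sum: "(\<Sum>(S, \<pi>)\<in>P1. of_int (sign \<pi>))
      = (\<Sum>(S, \<pi>)\<in>hook_terms (I - C) a (r - int (card C)) \<sigma>'. - ((-1) ^ card C) * of_int (sign \<pi>) :: real)"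
  proof (rule sum.reindex_bij_witness[where i = "\<lambda>(S, \<pi>). (S \<union> C, \<pi> \<circ> inv c)" and j = "\<lambda>(S, \<pi>). (S - C, \<pi> \<circ> c)"])
    fix z assume "z \<in> P1"
    then obtain S \<pi> where z: "z = (S, \<pi>)" "S \<subseteq> I - {a}" "C \<subseteq> S" "int (card S) = r"
        "\<pi> permutes insert a S" "\<And>s. s \<in> S \<Longrightarrow> \<sigma> (\<pi> s) = s"
      by (auto simp: P1_def hook_terms_def)
    have finS: "finite S"
      using z(2) assms(1) by (meson finite_Diff finite_subset)
    show "(case (case z of (S, \<pi>) \<Rightarrow> (S - C, \<pi> \<circ> c)) of (S, \<pi>) \<Rightarrow> (S \<union> C, \<pi> \<circ> inv c)) = z"
      using z(1,3) permutes_inv_o[OF c] by (auto simp: comp_assoc)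
    have fixC: "\<pi> (c x) = x" if "x \<in> C" for x
    proof -
      have "c x \<in> C"
        using that permutes_in_image[OF c] by simp
      moreover have "c x = \<sigma> x"
        using that by (simp add: c_def perm_restrict_def)
      ultimately have "\<sigma> (\<pi> (\<sigma> x)) = \<sigma> x"
        using z(3,6) by auto
      then show ?thesis
        using permutes_inj[OF \<sigma>] \<open>c x = \<sigma> x\<close> by (simp add: inj_eq)
    qed
    have "c permutes insert a S"
      using c by (rule permutes_subset) (use z(3) in auto)
    then have "\<pi> \<circ> c permutes insert a S"
      using z(5) by (rule permutes_compose)
    then have "\<pi> \<circ> c permutes insert a (S - C)"
      by (rule permutes_superset) (use fixC in auto)
    moreover have "\<sigma>' ((\<pi> \<circ> c) s) = s" if "s \<in> S - C" for s
    proof -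
      have "c s = s"
        using that permutes_not_in[OF c] by simp
      moreover have "\<pi> s \<in> I - C"
        using that z(2,6) by (intro stay[where \<pi> = \<pi> and s = s]) auto
      ultimately show ?thesis
        using \<sigma>'_eq z(6) that by simp
    qed
    moreover have "int (card (S - C)) = r - int (card C)"
      using z(3,4) finC finS card_mono[OF finS z(3)] by (simp add: card_Diff_subset)
    ultimately show "(case z of (S, \<pi>) \<Rightarrow> (S - C, \<pi> \<circ> c)) \<in> hook_terms (I - C) a (r - int (card C)) \<sigma>'"
      using z(1,2) by (auto simp: hook_terms_def)
    have "permutation \<pi>"
      using z(5) finS permutation_permutes by blast
    then have "sign (\<pi> \<circ> c) = sign \<pi> * - ((-1) ^ card C)"
      using permc by (simp add: sign_compose signc)
    then show "(case (case z of (S, \<pi>) \<Rightarrow> (S - C, \<pi> \<circ> c)) of (S, \<pi>) \<Rightarrow> - ((-1) ^ card C) * of_int (sign \<pi>))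
        = (case z of (S, \<pi>) \<Rightarrow> real_of_int (sign \<pi>))"
      by (simp add: z(1) flip: power_mult_distrib)
  next
    fix z assume "z \<in> hook_terms (I - C) a (r - int (card C)) \<sigma>'"
    then obtain S \<pi> where z: "z = (S, \<pi>)" "S \<subseteq> I - C - {a}" "int (card S) = r - int (card C)"
        "\<pi> permutes insert a S" "\<And>s. s \<in> S \<Longrightarrow> \<sigma>' (\<pi> s) = s"
      by (auto simp: hook_terms_def)
    have finS: "finite S"
      using z(2) assms(1) by (meson finite_Diff finite_subset)
    show "(case (case z of (S, \<pi>) \<Rightarrow> (S \<union> C, \<pi> \<circ> inv c)) of (S, \<pi>) \<Rightarrow> (S - C, \<pi> \<circ> c)) = z"
      using z(1,2) permutes_inv_o[OF c] by (auto simp: comp_assoc)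
    have "inv c permutes insert a (S \<union> C)" "\<pi> permutes insert a (S \<union> C)"
      by (rule permutes_subset[OF permutes_inv[OF c]], blast) (rule permutes_subset[OF z(4)], blast)
    then have "\<pi> \<circ> inv c permutes insert a (S \<union> C)"
      by (rule permutes_compose)
    moreover have "\<sigma> ((\<pi> \<circ> inv c) s) = s" if "s \<in> S \<union> C" for s
    proof (cases "s \<in> C")
      case True
      then have i: "inv c s \<in> C"
        using permutes_in_image[OF permutes_inv[OF c]] by simp
      then have "inv c s \<notin> insert a S"
        using z(2) a by auto
      then have "\<pi> (inv c s) = inv c s"
        by (rule permutes_not_in[OF z(4)])
      moreover have "\<sigma> (inv c s) = c (inv c s)"
        using i by (simp add: c_def perm_restrict_def)
      ultimately show ?thesis
        using permutes_inverses(1)[OF c] by simp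
    next
      case False
      then have "s \<in> S" "inv c s = s"
        using that permutes_not_in[OF permutes_inv[OF c]] by auto
      moreover have "\<pi> s \<in> I - C"
        using permutes_in_image[OF z(4), of s] \<open>s \<in> S\<close> z(2) a by auto
      ultimately show ?thesis
        using z(5)[of s] \<sigma>'_eq[of "\<pi> s"] by simp
    qed
    moreover have "int (card (S \<union> C)) = r"
      using z(2,3) finC finS by (subst card_Un_disjoint) auto
    ultimately show "(case z of (S, \<pi>) \<Rightarrow> (S \<union> C, \<pi> \<circ> inv c)) \<in> P1"
      using z(1,2) CI a by (auto simp: P1_def hook_terms_def)
  qed
  \<comment> \<open>An unchanged leg length \<open>card I - k\<close> belongs to the index
    \<open>k - card C\<close> on \<open>I - C\<close>, while a leg shortened by
    \<open>card C\<close> belongs to the index \<open>k\<close>.\<close>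
  have cardIC: "int (card (I - C)) = int (card I) - int (card C)"
    using card_mono[OF assms(1) CI] finC CI by (simp add: card_Diff_subset of_nat_diff)
  have IC: "finite (I - C)" "a \<in> I - C"
    using assms(1) a by auto
  have "hook_char k I \<sigma> = (\<Sum>(S, \<pi>)\<in>?P. of_int (sign \<pi>))"
    unfolding r_def by (rule hook_char_eq_sum_hook_terms[OF assms(1) a(1) \<sigma>])
  also have "\<dots> = (\<Sum>(S, \<pi>)\<in>hook_terms (I - C) a r \<sigma>'. of_int (sign \<pi>))
      - (-1) ^ card C * (\<Sum>(S, \<pi>)\<in>hook_terms (I - C) a (r - int (card C)) \<sigma>'. of_int (sign \<pi>))"
    unfolding split P0_eq P1_sum by (simp add: case_prod_unfold sum_distrib_left sum_negf)
  also have "(\<Sum>(S, \<pi>)\<in>hook_terms (I - C) a r \<sigma>'. of_int (sign \<pi>)) = hook_char (k - int (card C)) (I - C) \<sigma>'"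
    unfolding hook_char_eq_sum_hook_terms[OF IC \<sigma>'] cardIC r_def by simp
  also have "(\<Sum>(S, \<pi>)\<in>hook_terms (I - C) a (r - int (card C)) \<sigma>'. of_int (sign \<pi>)) = hook_char k (I - C) \<sigma>'"
    unfolding hook_char_eq_sum_hook_terms[OF IC \<sigma>'] cardIC r_def by (simp add: algebra_simps)
  finally show ?thesis .
qed

section \<open>Expansion of an immanant along the cycle through a point\<close>

text \<open>A cycle is kept as a permutation of all of \<open>I\<close>, so that it can be composed
  with a permutation of the complement. The identity belongs to the set and stands for
  \<open>v\<close> being a fixed point.\<close>

definition cycles_through :: "'a set \<Rightarrow> 'a \<Rightarrow> ('a \<Rightarrow> 'a) set" where
  "cycles_through I v = {c. c permutes I \<and> (\<forall>x. x \<notin> orbit c v \<longrightarrow> c x = x)}"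

text \<open>Every permutation of \<open>I\<close> is uniquely its cycle through \<open>v\<close>
  times a permutation of the rest. The product of entries factors accordingly, and
  \<open>hook_char_remove_orbit\<close> splits the character.\<close>

lemma hook_immanant_expand:
  assumes "finite I" and v: "v \<in> I"
  shows "hook_immanant k I M =
    (\<Sum>c\<in>cycles_through I v. (\<Prod>i\<in>orbit c v. M i (c i)) *
       (hook_immanant (k - int (card (orbit c v))) (I - orbit c v) M
        - (-1) ^ card (orbit c v) * hook_immanant k (I - orbit c v) M))"
proof -
  define w where "w c \<sigma> = (\<Prod>i\<in>orbit c v. M i (c i)) * (\<Prod>i\<in>I - orbit c v. M i (\<sigma> i)) *
      (hook_char (k - int (card (orbit c v))) (I - orbit c v) \<sigma>
        - (-1) ^ card (orbit c v) * hook_char k (I - orbit c v) \<sigma>)" for c \<sigma>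
  let ?Q = "SIGMA c:cycles_through I v. {\<sigma>. \<sigma> permutes I - orbit c v}"
  have "(\<Prod>i\<in>orbit c v. M i (c i)) *
       (hook_immanant (k - int (card (orbit c v))) (I - orbit c v) M
        - (-1) ^ card (orbit c v) * hook_immanant k (I - orbit c v) M)
      = (\<Sum>\<sigma> | \<sigma> permutes I - orbit c v. w c \<sigma>)" for c
    unfolding hook_immanant_eq_sum_hook_char w_def
    by (simp add: sum_distrib_left sum_subtractf algebra_simps)
  then have "(\<Sum>c\<in>cycles_through I v. (\<Prod>i\<in>orbit c v. M i (c i)) *
       (hook_immanant (k - int (card (orbit c v))) (I - orbit c v) M
        - (-1) ^ card (orbit c v) * hook_immanant k (I - orbit c v) M))
      = (\<Sum>c\<in>cycles_through I v. \<Sum>\<sigma> | \<sigma> permutes I - orbit c v. w c \<sigma>)"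
    by (simp only:)
  also have "\<dots> = (\<Sum>(c, \<sigma>)\<in>?Q. w c \<sigma>)"
  proof (rule sum.Sigma)
    show "finite (cycles_through I v)"
      by (rule finite_subset[OF _ finite_permutations[OF assms(1)]]) (auto simp: cycles_through_def)
    show "\<forall>c\<in>cycles_through I v. finite {\<sigma>. \<sigma> permutes I - orbit c v}"
      using assms(1) by (simp add: finite_permutations)
  qed
  also have "\<dots> = (\<Sum>\<sigma> | \<sigma> permutes I. hook_char k I \<sigma> * (\<Prod>i\<in>I. M i (\<sigma> i)))"
  proof (rule sym, rule sum.reindex_bij_witness[where
        j = "\<lambda>\<sigma>. (perm_restrict \<sigma> (orbit \<sigma> v), perm_restrict \<sigma> (I - orbit \<sigma> v))"
        and i = "\<lambda>(c, \<sigma>). c \<circ> \<sigma>"])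
    fix \<sigma> assume "\<sigma> \<in> {\<sigma>. \<sigma> permutes I}"
    then have \<sigma>: "\<sigma> permutes I" by simp
    have perm: "permutation \<sigma>"
      using \<sigma> assms(1) permutation_permutes by blast
    let ?C = "orbit \<sigma> v"
    have CI: "?C \<subseteq> I"
      using permutes_orbit_subset[OF \<sigma> v] .
    have cyc: "cyclic_on \<sigma> ?C"
      using cyclic_on_orbit'[OF perm] .
    let ?c = "perm_restrict \<sigma> ?C" and ?\<sigma>' = "perm_restrict \<sigma> (I - ?C)"
    have orb: "orbit ?c v = ?C"
      using perm by (rule orbit_perm_restrict_self)
    have \<sigma>': "?\<sigma>' permutes I - ?C"
      using \<sigma> cyc by (rule perm_restrict_diff_cyclic)
    have c: "?c permutes ?C"
      using \<sigma> cyc by (rule perm_restrict_cyclic_permutes)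
    then have "?c permutes I"
      using CI by (rule permutes_subset)
    then have "?c \<in> cycles_through I v"
      by (simp add: cycles_through_def orb) (simp add: perm_restrict_def)
    with \<sigma>' show "(?c, ?\<sigma>') \<in> ?Q"
      by (simp add: orb)
    show "(case (?c, ?\<sigma>') of (c, \<sigma>) \<Rightarrow> c \<circ> \<sigma>) = \<sigma>"
    proof -
      have "?c \<circ> ?\<sigma>' = perm_restrict \<sigma> (?C \<union> (I - ?C))"
        using c \<sigma>' by (intro perm_restrict_union) auto
      also have "?C \<union> (I - ?C) = I"
        using CI by blast
      finally show ?thesis
        by (simp only: prod.case perm_restrict_id[OF \<sigma>])
    qed
    have "(\<Prod>i\<in>I. M i (\<sigma> i)) = (\<Prod>i\<in>?C. M i (\<sigma> i)) * (\<Prod>i\<in>I - ?C. M i (\<sigma> i))"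
      using prod.subset_diff[OF CI assms(1), of "\<lambda>i. M i (\<sigma> i)"] by (simp add: mult.commute)
    also have "\<dots> = (\<Prod>i\<in>?C. M i (?c i)) * (\<Prod>i\<in>I - ?C. M i (?\<sigma>' i))"
      by (simp add: perm_restrict_def)
    finally show "(case (?c, ?\<sigma>') of (c, \<sigma>) \<Rightarrow> w c \<sigma>) = hook_char k I \<sigma> * (\<Prod>i\<in>I. M i (\<sigma> i))"
      by (simp add: w_def orb hook_char_remove_orbit[OF assms(1) \<sigma> v])
  next
    fix z assume "z \<in> ?Q"
    then obtain c \<sigma> where z: "z = (c, \<sigma>)" and cI: "c permutes I" and fix_c: "\<And>x. x \<notin> orbit c v \<Longrightarrow> c x = x"
      and \<sigma>: "\<sigma> permutes I - orbit c v"
      by (auto simp: cycles_through_def)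
    have perm: "permutation c"
      using cI assms(1) permutation_permutes by blast
    let ?C = "orbit c v"
    have \<sigma>_C: "\<sigma> x = x" if "x \<in> ?C" for x
      using permutes_not_in[OF \<sigma>] that by simp
    have c_\<sigma>: "c (\<sigma> x) = \<sigma> x" if "x \<notin> ?C" for x
    proof -
      have "\<sigma> x \<notin> ?C"
        using that permutes_in_image[OF \<sigma>, of x] permutes_not_in[OF \<sigma>, of x] by (cases "x \<in> I - ?C") auto
      then show ?thesis by (rule fix_c)
    qed
    \<comment> \<open>\<open>\<sigma>\<close> fixes the points of \<open>?C\<close>, so iterating
      the composite from \<open>v\<close> only sees \<open>c\<close>.\<close>
    have orb: "orbit (c \<circ> \<sigma>) v = ?C"
      by (rule orbit_cong[OF permutation_self_in_orbit[OF perm]]) (simp add: \<sigma>_C)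
    have "perm_restrict (c \<circ> \<sigma>) ?C = c"
      using fix_c \<sigma>_C by (auto simp: perm_restrict_def)
    moreover have "perm_restrict (c \<circ> \<sigma>) (I - ?C) = \<sigma>"
      using c_\<sigma> permutes_not_in[OF \<sigma>] by (auto simp: perm_restrict_def)
    ultimately show "(perm_restrict (case z of (c, \<sigma>) \<Rightarrow> c \<circ> \<sigma>) (orbit (case z of (c, \<sigma>) \<Rightarrow> c \<circ> \<sigma>) v),
        perm_restrict (case z of (c, \<sigma>) \<Rightarrow> c \<circ> \<sigma>) (I - orbit (case z of (c, \<sigma>) \<Rightarrow> c \<circ> \<sigma>) v)) = z"
      by (simp add: z orb)
    have "\<sigma> permutes I"
      using \<sigma> by (rule permutes_subset) auto
    then show "(case z of (c, \<sigma>) \<Rightarrow> c \<circ> \<sigma>) \<in> {\<sigma>. \<sigma> permutes I}"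
      using permutes_compose[OF _ cI] by (simp add: z)
  qed
  finally show ?thesis
    by (simp add: hook_immanant_eq_sum_hook_char)
qed

section \<open>Directed cycles as cyclic permutations\<close>

lemma (in pre_digraph) cas_conv_nth:
  "p \<noteq> [] \<Longrightarrow> cas u p v \<longleftrightarrow> tail G (hd p) = u \<and> head G (last p) = v \<and>
     (\<forall>i. Suc i < length p \<longrightarrow> head G (p ! i) = tail G (p ! Suc i))"
proof (induct p arbitrary: u)
  case (Cons e p)
  show ?case
  proof (cases "p = []")
    case False
    then obtain e' p' where p: "p = e' # p'" by (cases p) auto
    have "(\<forall>i. Suc i < length (e # p) \<longrightarrow> head G ((e # p) ! i) = tail G ((e # p) ! Suc i)) \<longleftrightarrow>
      head G e = tail G (hd p) \<and> (\<forall>i. Suc i < length p \<longrightarrow> head G (p ! i) = tail G (p ! Suc i))"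
      by (simp add: p All_less_Suc2)
    with Cons.hyps[OF False, of "head G e"] False show ?thesis
      by auto
  qed auto
qed simp

text \<open>Reading indices modulo the length treats the closing arc like the others, so no starting
  vertex has to be chosen. Distinct tails express simplicity because the final head repeats the
  first tail.\<close>

lemma (in wf_digraph) cycle_conv_nth:
  "cycle p \<longleftrightarrow> p \<noteq> [] \<and> set p \<subseteq> arcs G \<and> distinct (map (tail G) p) \<and>
     (\<forall>i<length p. head G (p ! i) = tail G (p ! (Suc i mod length p)))"
proof (cases "p = []")
  case False
  then have vs: "awalk_verts u p = map (tail G) p @ [head G (last p)]" for u
    by (simp add: awalk_verts_conv)
  have dist: "distinct (tl (awalk_verts u p)) \<longleftrightarrow> distinct (map (tail G) p)"
    if "head G (last p) = tail G (hd p)" for u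
    unfolding vs using False that by (cases p) auto
  have wrap: "(\<forall>i<length p. head G (p ! i) = tail G (p ! (Suc i mod length p))) \<longleftrightarrow>
    head G (last p) = tail G (hd p) \<and> (\<forall>i. Suc i < length p \<longrightarrow> head G (p ! i) = tail G (p ! Suc i))"
    (is "?L \<longleftrightarrow> ?R")
  proof
    assume L: ?L
    have "head G (p ! (length p - 1)) = tail G (p ! (Suc (length p - 1) mod length p))"
      using L False by simp
    then have "head G (last p) = tail G (hd p)"
      using False by (simp add: last_conv_nth hd_conv_nth)
    moreover have "head G (p ! i) = tail G (p ! Suc i)" if "Suc i < length p" for i
      using L[rule_format, of i] that by simp
    ultimately show ?R by blast
  next
    assume R: ?R
    show ?L
    proof (intro allI impI)
      fix i assume i: "i < length p"
      show "head G (p ! i) = tail G (p ! (Suc i mod length p))"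
      proof (cases "Suc i = length p")
        case True
        then have "i = length p - 1" by simp
        then show ?thesis
          using R False True by (simp add: last_conv_nth hd_conv_nth)
      next
        case False
        then show ?thesis using R i by simp
      qed
    qed
  qed
  have "tail G (hd p) \<in> verts G" if "set p \<subseteq> arcs G"
    using False that by (cases p) auto
  then show ?thesis
    unfolding cycle_def awalk_def cas_conv_nth[OF False] wrap using False dist by blast
qed (simp add: cycle_def)

context digraph begin

lemma arc_eqI:
  "e \<in> arcs G \<Longrightarrow> e' \<in> arcs G \<Longrightarrow> tail G e = tail G e' \<Longrightarrow> head G e = head G e' \<Longrightarrow> e = e'"
  by (rule no_multi_arcs) (auto simp: arc_to_ends_def)

definition arcs_of_perm :: "'a \<Rightarrow> ('a \<Rightarrow> 'a) \<Rightarrow> 'b set" where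
  "arcs_of_perm v c = {e \<in> arcs G. tail G e \<in> orbit c v \<and> head G e = c (tail G e)}"

text \<open>The permutation side of the bijection with \<open>cycles_at_vertex\<close>; the identity
  is left out because it accounts for the degree term.\<close>

definition arc_cycles_through :: "'a \<Rightarrow> ('a \<Rightarrow> 'a) set" where
  "arc_cycles_through v =
     {c \<in> cycles_through (verts G) v. c v \<noteq> v \<and> (\<forall>x\<in>orbit c v. (x, c x) \<in> arcs_ends G)}"

lemma arc_of_perm:
  assumes "c \<in> arc_cycles_through v" "x \<in> orbit c v"
  obtains e where "e \<in> arcs_of_perm v c" "tail G e = x" "head G e = c x"
proof -
  have "(x, c x) \<in> arcs_ends G"
    using assms by (auto simp: arc_cycles_through_def)
  then obtain e where "e \<in> arcs G" "tail G e = x" "head G e = c x"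
    by (auto simp: arcs_ends_def arc_to_ends_def)
  with assms(2) that show thesis
    by (auto simp: arcs_of_perm_def)
qed

lemma cycle_verts_arcs_of_perm:
  assumes "c \<in> arc_cycles_through v"
  shows "cycle_verts G (arcs_of_perm v c) = orbit c v"
proof
  show "orbit c v \<subseteq> cycle_verts G (arcs_of_perm v c)"
    using arc_of_perm[OF assms] unfolding cycle_verts_def by (metis image_eqI subsetI)
qed (auto simp: cycle_verts_def arcs_of_perm_def)

text \<open>The arcs leaving \<open>v\<close>, \<open>c v\<close>, \<open>c (c v)\<close> and so on,
  in this order, form the closed walk. Without parallel arcs each is determined by its ends, so the
  list exhausts the arc set.\<close>

lemma arcs_of_perm_in_cycles:
  assumes c: "c \<in> arc_cycles_through v"
  shows "arcs_of_perm v c \<in> cycles_at_vertex G v"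
proof -
  have "c permutes verts G"
    using c by (auto simp: arc_cycles_through_def cycles_through_def)
  then have perm: "permutation c"
    using finite_verts permutation_permutes by blast
  define x where "x i = (c ^^ i) v" for i
  define l where "l = card (orbit c v)"
  note enum = orbit_enumeration[OF perm, of v, folded x_def l_def]
  have "\<exists>e. e \<in> arcs_of_perm v c \<and> tail G e = y \<and> head G e = c y" if "y \<in> orbit c v" for y
    using arc_of_perm[OF c that] by blast
  then obtain f where f: "\<And>y. y \<in> orbit c v \<Longrightarrow> f y \<in> arcs_of_perm v c \<and> tail G (f y) = y \<and> head G (f y) = c y"
    by metis
  have x_mem: "x i \<in> orbit c v" for i
    unfolding x_def using permutation_self_in_orbit[OF perm] by (rule funpow_in_orbit)
  define p where "p = map (\<lambda>i. f (x i)) [0..<l]"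
  have len: "length p = l" and nth: "\<And>i. i < l \<Longrightarrow> p ! i = f (x i)"
    by (simp_all add: p_def)
  have set: "set p = arcs_of_perm v c"
  proof
    show "set p \<subseteq> arcs_of_perm v c"
      using f x_mem by (auto simp: p_def)
    show "arcs_of_perm v c \<subseteq> set p"
    proof
      fix e assume e: "e \<in> arcs_of_perm v c"
      then have "tail G e \<in> orbit c v" "head G e = c (tail G e)" "e \<in> arcs G"
        by (auto simp: arcs_of_perm_def)
      moreover from this(1) obtain i where "i < l" "tail G e = x i"
        using enum(2) by auto
      ultimately have "e = f (x i)"
        using f[of "x i"] by (intro arc_eqI) (auto simp: arcs_of_perm_def)
      with \<open>i < l\<close> show "e \<in> set p"
        by (auto simp: p_def)
    qed
  qed
  have "cycle p"
    unfolding cycle_conv_nth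
  proof (intro conjI allI impI)
    show "p \<noteq> []"
      using enum(4) len by auto
    show "set p \<subseteq> arcs G"
      unfolding set by (auto simp: arcs_of_perm_def)
    have "map (tail G) p = map x [0..<l]"
      using f x_mem by (simp add: p_def)
    then show "distinct (map (tail G) p)"
      using enum(1) by (simp add: distinct_map atLeast0LessThan)
    fix i assume "i < length p"
    then have i: "i < l" by (simp add: len)
    have "head G (p ! i) = x (Suc i)"
      using f[OF x_mem[of i]] nth[OF i] by (simp add: x_def)
    also have "\<dots> = x (Suc i mod l)"
    proof (cases "Suc i = l")
      case True
      then show ?thesis using enum(3) by (simp add: x_def)
    next
      case False
      then show ?thesis using i by simp
    qed
    also have "\<dots> = tail G (p ! (Suc i mod l))"
      using f[OF x_mem] enum(4) by (simp add: nth)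
    finally show "head G (p ! i) = tail G (p ! (Suc i mod length p))"
      by (simp add: len)
  qed
  then have "arcs_of_perm v c \<in> dicycles G"
    unfolding dicycles_def using set by auto
  then show ?thesis
    using permutation_self_in_orbit[OF perm]
    by (simp add: cycles_at_vertex_def cycle_verts_arcs_of_perm[OF c])
qed

text \<open>The tails of the arcs recover the orbit and their heads the values of \<open>c\<close>
  on it; elsewhere \<open>c\<close> is the identity.\<close>

lemma inj_on_arcs_of_perm: "inj_on (arcs_of_perm v) (arc_cycles_through v)"
proof (rule inj_onI)
  fix c c' assume c: "c \<in> arc_cycles_through v" "c' \<in> arc_cycles_through v"
    and eq: "arcs_of_perm v c = arcs_of_perm v c'"
  have orb: "orbit c v = orbit c' v"
    using cycle_verts_arcs_of_perm c eq by metis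
  show "c = c'"
  proof
    fix x
    show "c x = c' x"
    proof (cases "x \<in> orbit c v")
      case True
      then obtain e where "e \<in> arcs_of_perm v c" "tail G e = x" "head G e = c x"
        using arc_of_perm[OF c(1)] by blast
      then show ?thesis
        unfolding eq by (simp add: arcs_of_perm_def)
    next
      case False
      then show ?thesis
        using c orb by (simp add: arc_cycles_through_def cycles_through_def)
    qed
  qed
qed

text \<open>The permutation sends each vertex of the closed walk to the next one and fixes all
  others. The walk need not start at \<open>v\<close>.\<close>

lemma arcs_of_perm_surj:
  assumes "C \<in> cycles_at_vertex G v"
  shows "C \<in> arcs_of_perm v ` arc_cycles_through v"
proof -
  obtain p where p: "cycle p" "C = set p" and v: "v \<in> tail G ` set p"
    using assms by (auto simp: cycles_at_vertex_def dicycles_def cycle_verts_def)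
  define n where "n = length p"
  \<comment> \<open>Indexing the tails periodically by all naturals makes
    \<open>c (t i) = t (Suc i)\<close> hold across the end of the list as well.\<close>
  define t where "t i = tail G (p ! (i mod n))" for i
  have n: "0 < n" and arcs: "set p \<subseteq> arcs G" and dist: "distinct (map (tail G) p)"
    and hd: "\<And>i. i < n \<Longrightarrow> head G (p ! i) = t (Suc i)"
    using p(1) by (auto simp: cycle_conv_nth n_def t_def)
  have inj: "inj_on (tail G) (set p)"
    using dist by (simp add: distinct_map)
  have nth: "p ! (i mod n) \<in> set p" for i
    using n by (simp add: n_def)
  have tails: "tail G ` set p = range t"
  proof
    show "tail G ` set p \<subseteq> range t"
    proof
      fix y assume "y \<in> tail G ` set p"
      then obtain i where "i < n" "y = tail G (p ! i)"
        by (auto simp: in_set_conv_nth n_def)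
      then have "y = t i" by (simp add: t_def)
      then show "y \<in> range t" by blast
    qed
  qed (use nth in \<open>auto simp: t_def\<close>)
  define c where "c y = (if y \<in> range t then head G (the_inv_into (set p) (tail G) y) else y)" for y
  have ct: "c (t i) = t (Suc i)" for i
  proof -
    have "the_inv_into (set p) (tail G) (t i) = p ! (i mod n)"
      unfolding t_def using inj nth by (rule the_inv_into_f_f)
    then have "c (t i) = t (Suc (i mod n))"
      using hd[of "i mod n"] n by (simp add: c_def)
    then show ?thesis
      by (simp add: t_def mod_Suc_eq)
  qed
  obtain j where j: "v = t j"
    using v tails by auto
  have pow: "(c ^^ k) v = t (j + k)" for k
    by (induct k) (simp_all add: j ct)
  have periodic: "t (i + n) = t i" for i
    by (simp add: t_def)
  have "range t \<subseteq> c ` range t"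
  proof
    fix y assume "y \<in> range t"
    then obtain i where "y = t i" by blast
    \<comment> \<open>By periodicity \<open>i + (n - 1)\<close> serves as the predecessor of
      \<open>i\<close>, even for \<open>i = 0\<close>.\<close>
    then have "y = t (Suc (i + (n - 1)))"
      using periodic[of i] n by simp
    then have "y = c (t (i + (n - 1)))"
      by (simp only: ct)
    then show "y \<in> c ` range t" by blast
  qed
  moreover have "c ` range t \<subseteq> range t"
    using ct by auto
  moreover have fin: "finite (range t)"
    by (simp flip: tails)
  ultimately have "bij_betw c (range t) (range t)"
    unfolding bij_betw_def using finite_surj_inj[OF fin] by blast
  then have c_perm: "c permutes range t"
    by (rule bij_imp_permutes) (simp add: c_def)
  have orb: "orbit c v = range t"
  proof -
    have "permutation c"
      using c_perm fin permutation_permutes by blast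
    then have "orbit c v = {(c ^^ k) v | k. True}"
      by (rule orbit_altdef_permutation)
    also have "\<dots> = range t"
    proof (intro set_eqI iffI)
      fix y assume "y \<in> range t"
      then obtain i where "y = t i" by blast
      \<comment> \<open>From \<open>v = t j\<close>, the first \<open>n - j mod n\<close> steps
        return to position 0 of the walk, and \<open>i\<close> more reach
        \<open>t i\<close>.\<close>
      also have "t i = t (j + (i + (n - j mod n)))"
      proof -
        have "(j + (i + (n - j mod n))) mod n = (j mod n + (i + (n - j mod n))) mod n"
          by (simp only: mod_add_left_eq)
        also have "j mod n + (i + (n - j mod n)) = i + n"
          using mod_less_divisor[OF n, of j] by simp
        finally show ?thesis by (simp add: t_def)
      qed
      finally show "y \<in> {(c ^^ k) v | k. True}"
        using pow by (metis (mono_tags, lifting) mem_Collect_eq)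
    qed (auto simp: pow)
    finally show ?thesis .
  qed
  have sub: "range t \<subseteq> verts G"
    unfolding tails[symmetric] using arcs by auto
  have arc: "p ! (i mod n) \<in> arcs G" "tail G (p ! (i mod n)) = t i" "head G (p ! (i mod n)) = c (t i)" for i
    using nth[of i] arcs hd[of "i mod n"] n unfolding ct by (auto simp: t_def mod_Suc_eq)
  have "c v \<noteq> v"
    using no_loops[OF arc(1), of j] arc(2,3)[of j] j by auto
  moreover have "c \<in> cycles_through (verts G) v"
    using permutes_subset[OF c_perm sub] by (simp add: cycles_through_def orb) (simp add: c_def)
  moreover have "(x, c x) \<in> arcs_ends G" if x: "x \<in> orbit c v" for x
  proof -
    obtain i where "x = t i"
      using x unfolding orb by blast
    then show ?thesis
      unfolding arcs_ends_def arc_to_ends_def using arc[of i]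
      by (intro image_eqI[where x = "p ! (i mod n)"]) auto
  qed
  ultimately have "c \<in> arc_cycles_through v"
    by (simp add: arc_cycles_through_def)
  moreover have "C = arcs_of_perm v c"
  proof (intro set_eqI iffI)
    fix e assume "e \<in> C"
    then obtain i where "i < n" "e = p ! (i mod n)"
      unfolding p(2) by (auto simp: in_set_conv_nth n_def)
    then show "e \<in> arcs_of_perm v c"
      using arc[of i] by (simp add: arcs_of_perm_def orb)
  next
    fix e assume e: "e \<in> arcs_of_perm v c"
    then obtain i where "tail G e = t i"
      by (auto simp: arcs_of_perm_def orb)
    with e have "e = p ! (i mod n)"
      using arc[of i] by (intro arc_eqI) (auto simp: arcs_of_perm_def)
    then show "e \<in> C"
      using nth p(2) by simp
  qed
  ultimately show ?thesis
    by blast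
qed

lemma bij_betw_arcs_of_perm:
  "bij_betw (arcs_of_perm v) (arc_cycles_through v) (cycles_at_vertex G v)"
  unfolding bij_betw_def using inj_on_arcs_of_perm arcs_of_perm_in_cycles arcs_of_perm_surj by blast

end

section \<open>Expansions for the graph matrices\<close>

lemma hook_immanant_cong:
  assumes "\<And>i j. i \<in> I \<Longrightarrow> M i j = N i j"
  shows "hook_immanant k I M = hook_immanant k I N"
  unfolding hook_immanant_eq_sum_hook_char by (simp add: assms)

context digraph begin

text \<open>A cyclic permutation that moves \<open>v\<close> has no fixed point on its orbit, so no
  diagonal entry occurs and every factor is \<open>\<gamma>\<close> or 0.\<close>

lemma prod_H_mat_cycle:
  assumes c: "c \<in> cycles_through (verts G) v" "c v \<noteq> v"
  shows "(\<Prod>i\<in>orbit c v. H_mat \<beta> \<gamma> G i (c i))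
    = (if c \<in> arc_cycles_through v then \<gamma> ^ card (orbit c v) else 0)"
proof -
  have perm: "permutation c"
    using c permutes_imp_permutation[OF finite_verts] by (auto simp: cycles_through_def)
  have fin: "finite (orbit c v)"
    using perm by (intro finite_orbit permutation_self_in_orbit)
  have no_fixpoint: "c i \<noteq> i" if "i \<in> orbit c v" for i
  proof
    assume "c i = i"
    then have "orbit c i = {i}" by (simp add: orbit_eq_singleton_iff)
    then have "orbit c v = {i}"
      using orbit_cyclic_eq3[OF cyclic_on_orbit'[OF perm] that] by simp
    with c(2) permutation_self_in_orbit[OF perm, of v] show False
      using \<open>c i = i\<close> by auto
  qed
  have "H_mat \<beta> \<gamma> G i (c i) = (if (i, c i) \<in> arcs_ends G then \<gamma> else 0)" if "i \<in> orbit c v" for i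
    using no_fixpoint[OF that, symmetric] by (simp add: H_mat_def deg_mat_def adj_mat_def)
  then have "(\<Prod>i\<in>orbit c v. H_mat \<beta> \<gamma> G i (c i))
      = (\<Prod>i\<in>orbit c v. if (i, c i) \<in> arcs_ends G then \<gamma> else 0)"
    by (intro prod.cong refl)
  also have "\<dots> = (if c \<in> arc_cycles_through v then \<gamma> ^ card (orbit c v) else 0)"
    using fin c by (auto simp: arc_cycles_through_def)
  finally show ?thesis .
qed

lemma H_mat_diag: "H_mat \<beta> \<gamma> G v v = \<beta> * real (out_degree G v)"
proof -
  have "(v, v) \<notin> arcs_ends G"
    using no_loops by (auto simp: arcs_ends_def arc_to_ends_def)
  then show ?thesis
    by (simp add: H_mat_def deg_mat_def adj_mat_def)
qed

text \<open>In \<open>hook_immanant_expand\<close> the identity yields the degree term, and the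
  other cycles contribute only if all their steps are arcs.\<close>

lemma dH_expand_vertex:
  assumes v: "v \<in> verts G"
  shows "dH \<beta> \<gamma> k {} G =
    \<beta> * real (out_degree G v) * (dH \<beta> \<gamma> (k - 1) {v} G + dH \<beta> \<gamma> k {v} G)
    + (\<Sum>C\<in>cycles_at_vertex G v.
         \<gamma> ^ card (cycle_verts G C) *
         (dH \<beta> \<gamma> (k - int (card (cycle_verts G C))) (cycle_verts G C) G
          - (-1) ^ card (cycle_verts G C) * dH \<beta> \<gamma> k (cycle_verts G C) G))"
proof -
  define T where "T S = dH \<beta> \<gamma> (k - int (card S)) S G - (-1) ^ card S * dH \<beta> \<gamma> k S G" for S
  define w where "w c = (\<Prod>i\<in>orbit c v. H_mat \<beta> \<gamma> G i (c i)) * T (orbit c v)" for c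
  let ?A = "cycles_through (verts G) v" and ?D = "arc_cycles_through v"
  have fin: "finite ?A"
    by (rule finite_subset[OF _ finite_permutations[OF finite_verts]]) (auto simp: cycles_through_def)
  have orb_id: "orbit id v = {v}"
    by (simp add: orbit_eq_singleton_iff)
  have id: "c v = v \<longleftrightarrow> c = id" if "c \<in> ?A" for c
  proof
    assume "c v = v"
    then have "orbit c v = {v}" by (simp add: orbit_eq_singleton_iff)
    with that \<open>c v = v\<close> have "c x = x" for x
      by (cases "x = v") (auto simp: cycles_through_def)
    then show "c = id" by auto
  qed simp
  have "id \<in> ?A"
    by (simp add: cycles_through_def permutes_id)
  have "dH \<beta> \<gamma> k {} G = (\<Sum>c\<in>?A. w c)"
    unfolding w_def T_def dH_def using hook_immanant_expand[OF finite_verts v] by simp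
  also have "\<dots> = w id + (\<Sum>c\<in>?A - {id}. w c)"
    using fin \<open>id \<in> ?A\<close> by (rule sum.remove)
  \<comment> \<open>The orbit of \<open>id\<close> has one element, so the factor
    \<open>- (-1) ^ 1\<close> turns the difference into a sum.\<close>
  also have "w id = \<beta> * real (out_degree G v) * (dH \<beta> \<gamma> (k - 1) {v} G + dH \<beta> \<gamma> k {v} G)"
    by (simp add: w_def T_def orb_id H_mat_diag)
  also have "(\<Sum>c\<in>?A - {id}. w c) = (\<Sum>c\<in>?A - {id}. if c \<in> ?D then \<gamma> ^ card (orbit c v) * T (orbit c v) else 0)"
    by (intro sum.cong refl) (use id in \<open>auto simp: w_def prod_H_mat_cycle\<close>)
  also have "\<dots> = (\<Sum>c\<in>?D. \<gamma> ^ card (orbit c v) * T (orbit c v))"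
  proof -
    have "(?A - {id}) \<inter> ?D = ?D"
      by (auto simp: arc_cycles_through_def)
    with fin show ?thesis
      by (simp flip: sum.inter_restrict)
  qed
  also have "\<dots> = (\<Sum>c\<in>?D. \<gamma> ^ card (cycle_verts G (arcs_of_perm v c)) * T (cycle_verts G (arcs_of_perm v c)))"
    by (intro sum.cong refl) (simp add: cycle_verts_arcs_of_perm)
  also have "\<dots> = (\<Sum>C\<in>cycles_at_vertex G v. \<gamma> ^ card (cycle_verts G C) * T (cycle_verts G C))"
    by (rule sum.reindex_bij_betw[OF bij_betw_arcs_of_perm])
  finally show ?thesis
    unfolding T_def .
qed

lemma digraph_del_arc: "digraph (del_arc e)"
proof -
  interpret D: fin_digraph "del_arc e"
    by (rule fin_digraph_del_arc)
  show ?thesis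
    by unfold_locales (use no_loops in \<open>auto intro: arc_eqI simp: arc_to_ends_def\<close>)
qed

lemma cycles_at_vertex_del_arc:
  "cycles_at_vertex (del_arc e) v = {C \<in> cycles_at_vertex G v. e \<notin> C}"
proof -
  interpret D: digraph "del_arc e"
    by (rule digraph_del_arc)
  have "D.cycle p \<longleftrightarrow> cycle p \<and> e \<notin> set p" for p
    unfolding cycle_conv_nth D.cycle_conv_nth by auto
  then show ?thesis
    by (auto simp: cycles_at_vertex_def dicycles_def cycle_verts_def)
qed

text \<open>Deleting \<open>e\<close> can change the matrix only in the row of its tail, on and off
  the diagonal, and this row is removed along with \<open>S\<close>.\<close>

lemma dH_del_arc:
  assumes "tail G e \<in> S"
  shows "dH \<beta> \<gamma> k S (del_arc e) = dH \<beta> \<gamma> k S G"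
proof -
  have "H_mat \<beta> \<gamma> (del_arc e) i j = H_mat \<beta> \<gamma> G i j" if "i \<in> verts G - S" for i j
  proof -
    have i: "i \<noteq> tail G e" using that assms by auto
    then have "out_degree (del_arc e) i = out_degree G i"
      by (auto simp: out_degree_del_arc_iff)
    moreover have "(i, j) \<in> arcs_ends (del_arc e) \<longleftrightarrow> (i, j) \<in> arcs_ends G"
      using i by (auto simp: arcs_ends_def arc_to_ends_def)
    ultimately show ?thesis
      unfolding H_mat_def deg_mat_def adj_mat_def by (simp only:)
  qed
  then show ?thesis
    unfolding dH_def verts_del_arc by (rule hook_immanant_cong)
qed

text \<open>In the difference of the two vertex expansions at the tail, the out-degrees differ by 1,
  which leaves the term with \<open>\<beta>\<close>, and the cycles avoiding \<open>e\<close>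
  cancel.\<close>

lemma dH_expand_arc:
  assumes e: "e \<in> arcs G"
  shows "dH \<beta> \<gamma> k {} G =
    dH \<beta> \<gamma> k {} (del_arc e)
    + \<beta> * (dH \<beta> \<gamma> k {tail G e} (del_arc e) + dH \<beta> \<gamma> (k - 1) {tail G e} (del_arc e))
    + (\<Sum>C\<in>cycles_at_arc G e.
         \<gamma> ^ card (cycle_verts G C) *
         (dH \<beta> \<gamma> (k - int (card (cycle_verts G C))) (cycle_verts G C) G
          - (-1) ^ card (cycle_verts G C) * dH \<beta> \<gamma> k (cycle_verts G C) G))"
proof -
  let ?v = "tail G e"
  interpret D: digraph "del_arc e"
    by (rule digraph_del_arc)
  define W where "W C = \<gamma> ^ card (cycle_verts G C) *
         (dH \<beta> \<gamma> (k - int (card (cycle_verts G C))) (cycle_verts G C) G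
          - (-1) ^ card (cycle_verts G C) * dH \<beta> \<gamma> k (cycle_verts G C) G)" for C
  have v: "?v \<in> verts G" "?v \<in> verts (del_arc e)"
    using e by auto
  \<comment> \<open>Every cycle here contains the tail of \<open>e\<close>, so by
    \<open>dH_del_arc\<close> its weight is the same in both graphs.\<close>
  have W_del: "\<gamma> ^ card (cycle_verts (del_arc e) C) *
         (dH \<beta> \<gamma> (k - int (card (cycle_verts (del_arc e) C))) (cycle_verts (del_arc e) C) (del_arc e)
          - (-1) ^ card (cycle_verts (del_arc e) C) * dH \<beta> \<gamma> k (cycle_verts (del_arc e) C) (del_arc e)) = W C"
    if "C \<in> cycles_at_vertex (del_arc e) ?v" for C
  proof -
    have "cycle_verts (del_arc e) C = cycle_verts G C"
      by (simp add: cycle_verts_def)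
    moreover have "?v \<in> cycle_verts (del_arc e) C"
      using that by (simp add: cycles_at_vertex_def)
    ultimately show ?thesis
      by (simp add: W_def dH_del_arc)
  qed
  have "cycles_at_vertex G ?v \<subseteq> Pow (arcs G)"
    by (auto simp: cycles_at_vertex_def dicycles_def cycle_conv_nth)
  then have fin: "finite (cycles_at_vertex G ?v)"
    by (rule finite_subset) simp
  have arc: "cycles_at_arc G e = {C \<in> cycles_at_vertex G ?v. e \<in> C}"
    by (auto simp: cycles_at_arc_def cycles_at_vertex_def cycle_verts_def)
  have "(\<Sum>C\<in>cycles_at_vertex G ?v. W C)
      = (\<Sum>C | C \<in> cycles_at_vertex G ?v \<and> e \<notin> C. W C) + (\<Sum>C\<in>cycles_at_arc G e. W C)"
    unfolding arc using fin by (subst sum.union_disjoint[symmetric]) (auto intro!: sum.cong)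
  moreover have "dH \<beta> \<gamma> k {} (del_arc e) =
      \<beta> * real (out_degree (del_arc e) ?v) * (dH \<beta> \<gamma> (k - 1) {?v} G + dH \<beta> \<gamma> k {?v} G)
      + (\<Sum>C | C \<in> cycles_at_vertex G ?v \<and> e \<notin> C. W C)"
    unfolding D.dH_expand_vertex[OF v(2)] using W_del
    by (simp add: dH_del_arc cycles_at_vertex_del_arc)
  moreover have "dH \<beta> \<gamma> k {} G =
      \<beta> * real (out_degree G ?v) * (dH \<beta> \<gamma> (k - 1) {?v} G + dH \<beta> \<gamma> k {?v} G)
      + (\<Sum>C\<in>cycles_at_vertex G ?v. W C)"
    unfolding W_def by (rule dH_expand_vertex[OF v(1)])
  moreover have "real (out_degree G ?v) = real (out_degree (del_arc e) ?v) + 1"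
  proof -
    \<comment> \<open>Positivity keeps the subtraction of 1 on the naturals from truncating.\<close>
    have "0 < out_degree G ?v"
      unfolding out_degree_def using e by (auto simp: card_gt_0_iff)
    then show ?thesis
      using e by (simp add: out_degree_del_arc_iff)
  qed
  ultimately show ?thesis
    unfolding W_def by (simp add: dH_del_arc algebra_simps)
qed

end

theorem theorem1p6:
  fixes G :: "('a, 'b) pre_digraph" and \<beta> \<gamma> :: real and k :: int
  assumes "digraph G"
  shows
    "(\<forall>v\<in>verts G.
        dH \<beta> \<gamma> k {} G =
          \<beta> * real (out_degree G v) * (dH \<beta> \<gamma> (k - 1) {v} G + dH \<beta> \<gamma> k {v} G)
          + (\<Sum>C\<in>cycles_at_vertex G v.
               \<gamma> ^ card (cycle_verts G C) *
               (dH \<beta> \<gamma> (k - int (card (cycle_verts G C))) (cycle_verts G C) G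
                - (-1) ^ card (cycle_verts G C) * dH \<beta> \<gamma> k (cycle_verts G C) G)))
     \<and>
     (\<forall>e\<in>arcs G.
        dH \<beta> \<gamma> k {} G =
          dH \<beta> \<gamma> k {} (pre_digraph.del_arc G e)
          + \<beta> * (dH \<beta> \<gamma> k {tail G e} (pre_digraph.del_arc G e)
                 + dH \<beta> \<gamma> (k - 1) {tail G e} (pre_digraph.del_arc G e))
          + (\<Sum>C\<in>cycles_at_arc G e.
               \<gamma> ^ card (cycle_verts G C) *
               (dH \<beta> \<gamma> (k - int (card (cycle_verts G C))) (cycle_verts G C) G
                - (-1) ^ card (cycle_verts G C) * dH \<beta> \<gamma> k (cycle_verts G C) G)))"
proof -
  interpret digraph G by fact
  show ?thesis
    using dH_expand_vertex dH_expand_arc by blast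
qed

end
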